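(* Let $H$ be a complex Hilbert space, let $m\in\mathbb{Z}_{1}$ and let $S\in\mathbf{B}(\ell^{2}(\mathbb{Z},H))$ be an $m$-isometric bilateral weighted shift with positive and invertible weights $(S_{j})_{j\in\mathbb{Z}}\subset\mathbf{B}(H)$. The following conditions are equivalent: (i) all weights of $S$ commute (with each other); (ii) $S_{1},\ldots,S_{m-1}$ commute; (iii) if $p(z)=A_{m-1}z^{m-1}+\ldots+A_{1}z+I\in\mathbf{B}(H)_{m-1}[z]$ satisfies $p(n)=\lvert S_{n}\cdots S_{1}\rvert^{2}$ and $p(-n)=\lvert S_{-n+1}^{*}\cdots S_{0}^{*}\rvert^{-2}$ for every $n\in\mathbb{Z}_{1}$, then $A_{1},\ldots,A_{m-1}$ commute.
   Context: $\mathbb{Z}_{p}=\{n\in\mathbb{Z}: n\ge p\}$. $\mathbf{B}(H)$ is the algebra of bounded linear operators on a complex Hilbert space $H$; invertible means invertible in $\mathbf{B}(H)$; $\lvert T\rvert=(T^{*}T)^{1/2}$ and, for invertible $T$, $\lvert T\rvert^{-2}=(T^{*}T)^{-1}$. An operator $T\in\mathbf{B}(H)$ is called positive if $\langle Tf,f\rangle>0$ for every $f\in H$, $f\neq 0$. The product $S_{-n+1}^{*}\cdots S_{0}^{*}$ is $S_{-n+1}^{*}S_{-n+2}^{*}\cdots S_{-1}^{*}S_{0}^{*}$ (increasing indices), and $S_{n}\cdots S_{1}$ has decreasing indices. $\ell^{2}(\mathbb{Z},H)$ is the Hilbert space of square-summable two-sided sequences $(h_{i})_{i\in\mathbb{Z}}$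 in $H$. For a uniformly bounded sequence $(S_{i})_{i\in\mathbb{Z}}\subset\mathbf{B}(H)$, the bilateral weighted shift $S$ with weights $(S_{i})_{i\in\mathbb{Z}}$ is the bounded operator on $\ell^{2}(\mathbb{Z},H)$ given by $S(h_{i})_{i\in\mathbb{Z}}=(S_{i}h_{i-1})_{i\in\mathbb{Z}}$. A bounded operator $T$ is $m$-isometric ($m\in\mathbb{Z}_{1}$) if $\sum_{k=0}^{m}\binom{m}{k}(-1)^{m-k}T^{*k}T^{k}=0$. $\mathbf{B}(H)_{n}[z]$ denotes the space of polynomials $p(z)=\sum_{j=0}^{n}A_{j}z^{j}$ with coefficients $A_{j}\in\mathbf{B}(H)$ (degree at most $n$), evaluated at scalars $z\in\mathbb{C}$. *)

theory Defs
  imports "HOL-Analysis.Analysis" "HOL-Computational_Algebra.Polynomial"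
begin

class complex_vector = real_vector +
  fixes scaleC :: "complex \<Rightarrow> 'a \<Rightarrow> 'a"  (infixr \<open>*\<^sub>C\<close> 75)
  assumes scaleC_add_right: "c *\<^sub>C (x + y) = c *\<^sub>C x + c *\<^sub>C y"
    and scaleC_add_left: "(c + d) *\<^sub>C x = c *\<^sub>C x + d *\<^sub>C x"
    and scaleC_scaleC: "c *\<^sub>C d *\<^sub>C x = (c * d) *\<^sub>C x"
    and scaleC_one: "1 *\<^sub>C x = x"
    and scaleR_scaleC: "r *\<^sub>R x = complex_of_real r *\<^sub>C x"

text \<open>The inner product is linear in the first argument and conjugate-linear in the second.
  It is positive definite because the norm it determines is one.\<close>

class complex_inner = complex_vector + real_normed_vector +
  fixes cinner :: "'a \<Rightarrow> 'a \<Rightarrow> complex"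
  assumes cinner_commute: "cinner x y = cnj (cinner y x)"
    and cinner_add_left: "cinner (x + y) z = cinner x z + cinner y z"
    and cinner_scaleC_left: "cinner (c *\<^sub>C x) y = c * cinner x y"
    and cinner_self: "cinner x x = complex_of_real ((norm x)\<^sup>2)"

class complex_hilbert = complex_inner + complete_space

subclass (in complex_hilbert) banach ..

lemma norm_scaleC: "norm (c *\<^sub>C (x :: 'a :: complex_inner)) = norm c * norm x"
proof -
  have "cinner (c *\<^sub>C x) (c *\<^sub>C x) = c * cnj (c * cinner x x)"
    by (metis cinner_commute cinner_scaleC_left)
  also have "\<dots> = (c * cnj c) * complex_of_real ((norm x)\<^sup>2)"
    by (simp add: cinner_self)
  also have "\<dots> = complex_of_real ((norm c * norm x)\<^sup>2)"
    by (simp add: complex_norm_square[symmetric] power_mult_distrib)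
  finally have "(norm (c *\<^sub>C x))\<^sup>2 = (norm c * norm x)\<^sup>2"
    using cinner_self of_real_eq_iff by metis
  then show ?thesis
    by (simp add: power2_eq_iff_nonneg)
qed

lemma cinner_scaleR_left: "cinner (r *\<^sub>R x) y = complex_of_real r * cinner x y"
  by (simp add: scaleR_scaleC cinner_scaleC_left)

lemma cinner_add_right: "cinner x (y + z) = cinner x y + cinner x z"
  by (metis cinner_add_left cinner_commute complex_cnj_add)

lemma cinner_scaleC_right: "cinner x (c *\<^sub>C y) = cnj c * cinner x y"
  by (metis cinner_commute cinner_scaleC_left complex_cnj_mult)

lemma Re_cinner_bound: "2 * Re (cinner x y) \<le> (norm x)\<^sup>2 + (norm y)\<^sup>2"
  for x y :: "'a :: complex_inner"
proof -
  define z where "z = (- 1) *\<^sub>C y"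
  have "cinner (x + z) (x + z)
      = cinner x x - cinner x y - cnj (cinner x y) + cinner y y"
    unfolding z_def
    by (simp add: cinner_add_left cinner_add_right cinner_scaleC_left cinner_scaleC_right
        cinner_commute[of y x])
  then have "Re (cinner (x + z) (x + z)) = (norm x)\<^sup>2 - 2 * Re (cinner x y) + (norm y)\<^sup>2"
    by (simp add: cinner_self)
  moreover have "0 \<le> Re (cinner (x + z) (x + z))"
    by (simp add: cinner_self)
  ultimately show ?thesis by linarith
qed

lemma norm_cinner_le: "norm (cinner x y) \<le> (norm x)\<^sup>2 + (norm y)\<^sup>2"
  for x y :: "'a :: complex_inner"
proof (cases "cinner x y = 0")
  case False
  define c where "c = cnj (sgn (cinner x y))"
  have 1: "norm c = 1"
    using False by (simp add: c_def norm_sgn)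
  have "cinner (c *\<^sub>C x) y = complex_of_real (norm (cinner x y))"
  proof -
    have "cinner (c *\<^sub>C x) y = cnj (sgn (cinner x y)) * cinner x y"
      by (simp add: c_def cinner_scaleC_left)
    also have "\<dots> = (cinner x y * cnj (cinner x y)) / complex_of_real (norm (cinner x y))"
      by (simp add: sgn_eq)
    also have "\<dots> = complex_of_real (norm (cinner x y))"
      using False by (simp add: complex_norm_square[symmetric] power2_eq_square)
    finally show ?thesis .
  qed
  then have "2 * norm (cinner x y) \<le> (norm x)\<^sup>2 + (norm y)\<^sup>2"
    using Re_cinner_bound[of "c *\<^sub>C x" y] by (simp add: norm_scaleC 1)
  then show ?thesis
    using norm_ge_zero[of "cinner x y"] by linarith
qed simp

text \<open>Only complex-linear operators are admitted: \<^const>\<open>bounded_linear\<close> alone gives real linearity.\<close>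

typedef (overloaded) 'a bop =
  "{T :: 'a :: complex_inner \<Rightarrow> 'a. bounded_linear T \<and> (\<forall>c x. T (c *\<^sub>C x) = c *\<^sub>C T x)}"
  morphisms bop_apply Abs_bop
proof
  show "(\<lambda>x. 0) \<in> {T :: 'a \<Rightarrow> 'a. bounded_linear T \<and> (\<forall>c x. T (c *\<^sub>C x) = c *\<^sub>C T x)}"
    by (auto simp: bounded_linear_zero) (metis add_cancel_right_right scaleC_add_right)
qed

setup_lifting type_definition_bop

lemma scaleC_zero_right [simp]: "c *\<^sub>C (0 :: 'a :: complex_vector) = 0"
  by (metis add_cancel_right_right scaleC_add_right)

lemma scaleC_minus_right: "c *\<^sub>C (- x) = - (c *\<^sub>C (x :: 'a :: complex_vector))"
  by (metis add.right_inverse add_eq_0_iff scaleC_add_right scaleC_zero_right)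

lemma scaleC_diff_right: "c *\<^sub>C (x - y) = c *\<^sub>C x - c *\<^sub>C (y :: 'a :: complex_vector)"
  by (metis add_uminus_conv_diff scaleC_add_right scaleC_minus_right)

lemma bounded_linear_scaleC: "bounded_linear (\<lambda>x :: 'a :: complex_inner. c *\<^sub>C x)"
proof
  show "\<exists>K. \<forall>x :: 'a. norm (c *\<^sub>C x) \<le> norm x * K"
    by (rule exI[of _ "norm c"]) (simp add: norm_scaleC mult.commute)
qed (simp_all add: scaleC_add_right scaleR_scaleC scaleC_scaleC mult.commute)

instantiation bop :: (complex_inner) "{complex_vector, real_normed_vector}"
begin

lift_definition norm_bop :: "'a bop \<Rightarrow> real" is onorm .

lift_definition zero_bop :: "'a bop" is "\<lambda>x. 0"
  by (simp add: bounded_linear_zero)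

lift_definition plus_bop :: "'a bop \<Rightarrow> 'a bop \<Rightarrow> 'a bop" is "\<lambda>T R x. T x + R x"
  by (simp add: bounded_linear_add scaleC_add_right)

lift_definition minus_bop :: "'a bop \<Rightarrow> 'a bop \<Rightarrow> 'a bop" is "\<lambda>T R x. T x - R x"
  by (simp add: bounded_linear_sub scaleC_diff_right)

lift_definition uminus_bop :: "'a bop \<Rightarrow> 'a bop" is "\<lambda>T x. - T x"
  by (simp add: bounded_linear_minus scaleC_minus_right)

lift_definition scaleC_bop :: "complex \<Rightarrow> 'a bop \<Rightarrow> 'a bop" is "\<lambda>c T x. c *\<^sub>C T x"
  by (simp add: scaleC_scaleC mult.commute bounded_linear_compose[OF bounded_linear_scaleC])

lift_definition scaleR_bop :: "real \<Rightarrow> 'a bop \<Rightarrow> 'a bop" is "\<lambda>r T x. r *\<^sub>R T x"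
  by (simp add: scaleR_scaleC scaleC_scaleC mult.commute
      bounded_linear_compose[OF bounded_linear_scaleC])

definition dist_bop :: "'a bop \<Rightarrow> 'a bop \<Rightarrow> real"
  where "dist_bop T R = norm (T - R)"

definition sgn_bop :: "'a bop \<Rightarrow> 'a bop"
  where "sgn_bop T = inverse (norm T) *\<^sub>R T"

definition uniformity_bop :: "('a bop \<times> 'a bop) filter"
  where [code del]: "uniformity_bop = (INF e\<in>{0<..}. principal {(T, R). dist T R < e})"

definition open_bop :: "'a bop set \<Rightarrow> bool"
  where [code del]: "open_bop U = (\<forall>T\<in>U. \<forall>\<^sub>F (T', R) in uniformity. T' = T \<longrightarrow> R \<in> U)"

instance
proof
  fix T R :: "'a bop" and r :: real
  show "norm T = 0 \<longleftrightarrow> T = 0"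
    by transfer (auto simp: onorm_eq_0 fun_eq_iff)
  show "norm (T + R) \<le> norm T + norm R"
    by transfer (auto simp: onorm_triangle)
  show "norm (r *\<^sub>R T) = \<bar>r\<bar> * norm T"
    by transfer (auto simp: onorm_scaleR)
qed (transfer; simp add: fun_eq_iff scaleC_add_left scaleC_add_right scaleC_scaleC scaleC_one
      scaleR_scaleC add.assoc add.commute dist_bop_def sgn_bop_def uniformity_bop_def open_bop_def;
      fail
    | simp add: dist_bop_def sgn_bop_def uniformity_bop_def open_bop_def)+

end

instantiation bop :: (complex_inner) "{ring, monoid_mult}"
begin

lift_definition one_bop :: "'a bop" is "\<lambda>x. x"
  by simp

lift_definition times_bop :: "'a bop \<Rightarrow> 'a bop \<Rightarrow> 'a bop" is "\<lambda>T R x. T (R x)"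
  by (simp add: bounded_linear_compose)

instance
  by standard
    (transfer; auto simp: fun_eq_iff linear_add bounded_linear.linear)+

end

text \<open>For a bounded \<open>T\<close> on a Hilbert space, the adjoint exists and is unique
  (Riesz representation).\<close>

definition adj :: "'a :: complex_hilbert bop \<Rightarrow> 'a bop" where
  "adj T = (THE R. \<forall>x y. cinner (bop_apply T x) y = cinner x (bop_apply R y))"

definition op_invertible :: "'a :: complex_hilbert bop \<Rightarrow> bool" where
  "op_invertible T \<longleftrightarrow> (\<exists>R. T * R = 1 \<and> R * T = 1)"

definition op_inv :: "'a :: complex_hilbert bop \<Rightarrow> 'a bop" where
  "op_inv T = (THE R. T * R = 1 \<and> R * T = 1)"

text \<open>Positivity is strict here; the square root is taken among non-strictly positive operators,
  where it is unique.\<close>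

definition op_pos :: "'a :: complex_hilbert bop \<Rightarrow> bool" where
  "op_pos T \<longleftrightarrow> (\<forall>f. f \<noteq> 0 \<longrightarrow> cinner (bop_apply T f) f \<in> \<real> \<and> Re (cinner (bop_apply T f) f) > 0)"

definition op_nonneg :: "'a :: complex_hilbert bop \<Rightarrow> bool" where
  "op_nonneg T \<longleftrightarrow> (\<forall>f. cinner (bop_apply T f) f \<in> \<real> \<and> Re (cinner (bop_apply T f) f) \<ge> 0)"

definition op_sqrt :: "'a :: complex_hilbert bop \<Rightarrow> 'a bop" where
  "op_sqrt A = (THE R. op_nonneg R \<and> R ^ 2 = A)"

definition op_abs :: "'a :: complex_hilbert bop \<Rightarrow> 'a bop" where
  "op_abs T = op_sqrt (adj T * T)"

definition m_isometric :: "nat \<Rightarrow> 'a :: complex_hilbert bop \<Rightarrow> bool" where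
  "m_isometric m T \<longleftrightarrow>
     (\<Sum>k\<le>m. (of_nat (m choose k) * (- 1) ^ (m - k)) *\<^sub>C (adj T ^ k * T ^ k)) = 0"

text \<open>Operator-coefficient polynomials are evaluated at complex scalars, so \<^const>\<open>poly\<close>,
  which evaluates in the coefficient ring, does not apply.\<close>

definition op_poly :: "'a :: complex_hilbert bop poly \<Rightarrow> complex \<Rightarrow> 'a bop" where
  "op_poly p z = (\<Sum>j\<le>degree p. z ^ j *\<^sub>C coeff p j)"

typedef (overloaded) 'a ell2 =
  "{h :: int \<Rightarrow> 'a :: complex_inner. (\<lambda>i. (norm (h i))\<^sup>2) summable_on UNIV}"
  morphisms ell2_nth Abs_ell2
  by (rule exI[of _ "\<lambda>_. 0"]) simp

setup_lifting type_definition_ell2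

lemma ell2_L2_set_le:
  assumes "(\<lambda>i. (norm (h i :: 'a :: complex_inner))\<^sup>2) summable_on (UNIV :: int set)"
  shows "L2_set (\<lambda>i. norm (h i)) F \<le> sqrt (\<Sum>\<^sub>\<infinity>i. (norm (h i))\<^sup>2)"
proof (cases "finite F")
  case True
  then show ?thesis
    unfolding L2_set_def
    by (intro real_sqrt_le_mono finite_sum_le_infsum assms) auto
qed (simp add: infsum_nonneg)

lemma ell2_L2_set_bound:
  fixes h :: "int \<Rightarrow> 'a :: complex_inner"
  assumes "\<And>F. finite F \<Longrightarrow> L2_set (\<lambda>i. norm (h i)) F \<le> B"
  shows "(\<lambda>i. (norm (h i))\<^sup>2) summable_on UNIV" "sqrt (\<Sum>\<^sub>\<infinity>i. (norm (h i))\<^sup>2) \<le> B"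
proof -
  have B: "0 \<le> B"
    using assms[of "{}"] by simp
  have le: "(\<Sum>i\<in>F. (norm (h i))\<^sup>2) \<le> B\<^sup>2" if "finite F" for F
    using assms[OF that] B unfolding L2_set_def by (simp add: real_sqrt_le_iff' sqrt_le_D)
  show s: "(\<lambda>i. (norm (h i))\<^sup>2) summable_on UNIV"
    by (rule nonneg_bdd_above_summable_on) (auto intro!: bdd_aboveI2 le)
  have "(\<Sum>\<^sub>\<infinity>i. (norm (h i))\<^sup>2) \<le> B\<^sup>2"
    by (rule infsum_le_finite_sums[OF s le])
  then show "sqrt (\<Sum>\<^sub>\<infinity>i. (norm (h i))\<^sup>2) \<le> B"
    by (rule real_le_lsqrt[OF B])
qed

lemma ell2_add:
  fixes h g :: "int \<Rightarrow> 'a :: complex_inner"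
  assumes h: "(\<lambda>i. (norm (h i))\<^sup>2) summable_on UNIV"
    and g: "(\<lambda>i. (norm (g i))\<^sup>2) summable_on UNIV"
  shows "(\<lambda>i. (norm (h i + g i))\<^sup>2) summable_on UNIV"
    "sqrt (\<Sum>\<^sub>\<infinity>i. (norm (h i + g i))\<^sup>2)
      \<le> sqrt (\<Sum>\<^sub>\<infinity>i. (norm (h i))\<^sup>2) + sqrt (\<Sum>\<^sub>\<infinity>i. (norm (g i))\<^sup>2)"
proof -
  have "L2_set (\<lambda>i. norm (h i + g i)) F
      \<le> sqrt (\<Sum>\<^sub>\<infinity>i. (norm (h i))\<^sup>2) + sqrt (\<Sum>\<^sub>\<infinity>i. (norm (g i))\<^sup>2)" for F
  proof -
    have "L2_set (\<lambda>i. norm (h i + g i)) F \<le> L2_set (\<lambda>i. norm (h i) + norm (g i)) F"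
      by (rule L2_set_mono) (auto simp: norm_triangle_ineq)
    also have "\<dots> \<le> L2_set (\<lambda>i. norm (h i)) F + L2_set (\<lambda>i. norm (g i)) F"
      by (rule L2_set_triangle_ineq)
    also have "\<dots> \<le> sqrt (\<Sum>\<^sub>\<infinity>i. (norm (h i))\<^sup>2) + sqrt (\<Sum>\<^sub>\<infinity>i. (norm (g i))\<^sup>2)"
      by (intro add_mono ell2_L2_set_le h g)
    finally show ?thesis .
  qed
  from ell2_L2_set_bound[OF this]
  show "(\<lambda>i. (norm (h i + g i))\<^sup>2) summable_on UNIV"
    "sqrt (\<Sum>\<^sub>\<infinity>i. (norm (h i + g i))\<^sup>2)
      \<le> sqrt (\<Sum>\<^sub>\<infinity>i. (norm (h i))\<^sup>2) + sqrt (\<Sum>\<^sub>\<infinity>i. (norm (g i))\<^sup>2)"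
    by blast+
qed

lemma ell2_scaleC:
  fixes h :: "int \<Rightarrow> 'a :: complex_inner"
  assumes "(\<lambda>i. (norm (h i))\<^sup>2) summable_on UNIV"
  shows "(\<lambda>i. (norm (c *\<^sub>C h i))\<^sup>2) summable_on UNIV"
  using summable_on_cmult_right[OF assms, of "(norm c)\<^sup>2"]
  by (simp add: norm_scaleC power_mult_distrib)

lemma ell2_cinner_summable:
  fixes h g :: "int \<Rightarrow> 'a :: complex_inner"
  assumes "(\<lambda>i. (norm (h i))\<^sup>2) summable_on UNIV" "(\<lambda>i. (norm (g i))\<^sup>2) summable_on UNIV"
  shows "(\<lambda>i. cinner (h i) (g i)) summable_on UNIV"
  by (rule abs_summable_summable, rule Infinite_Sum.abs_summable_on_comparison_test'
      [OF summable_on_add[OF assms]]) (rule norm_cinner_le)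

instantiation ell2 :: (complex_inner) complex_inner
begin

lift_definition zero_ell2 :: "'a ell2" is "\<lambda>_. 0"
  by simp

lift_definition plus_ell2 :: "'a ell2 \<Rightarrow> 'a ell2 \<Rightarrow> 'a ell2" is "\<lambda>h g i. h i + g i"
  by (rule ell2_add)

lift_definition uminus_ell2 :: "'a ell2 \<Rightarrow> 'a ell2" is "\<lambda>h i. - h i"
  by simp

lift_definition minus_ell2 :: "'a ell2 \<Rightarrow> 'a ell2 \<Rightarrow> 'a ell2" is "\<lambda>h g i. h i - g i"
  subgoal for h g using ell2_add(1)[of h "\<lambda>i. - g i"] by simp
  done

lift_definition scaleC_ell2 :: "complex \<Rightarrow> 'a ell2 \<Rightarrow> 'a ell2" is "\<lambda>c h i. c *\<^sub>C h i"
  by (rule ell2_scaleC)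

lift_definition scaleR_ell2 :: "real \<Rightarrow> 'a ell2 \<Rightarrow> 'a ell2" is "\<lambda>r h i. r *\<^sub>R h i"
  unfolding scaleR_scaleC by (rule ell2_scaleC)

lift_definition cinner_ell2 :: "'a ell2 \<Rightarrow> 'a ell2 \<Rightarrow> complex" is
  "\<lambda>h g. \<Sum>\<^sub>\<infinity>i. cinner (h i) (g i)" .

lift_definition norm_ell2 :: "'a ell2 \<Rightarrow> real" is
  "\<lambda>h. sqrt (\<Sum>\<^sub>\<infinity>i. (norm (h i))\<^sup>2)" .

definition dist_ell2 :: "'a ell2 \<Rightarrow> 'a ell2 \<Rightarrow> real"
  where "dist_ell2 h g = norm (h - g)"

definition sgn_ell2 :: "'a ell2 \<Rightarrow> 'a ell2"
  where "sgn_ell2 h = inverse (norm h) *\<^sub>R h"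

definition uniformity_ell2 :: "('a ell2 \<times> 'a ell2) filter"
  where [code del]: "uniformity_ell2 = (INF e\<in>{0<..}. principal {(h, g). dist h g < e})"

definition open_ell2 :: "'a ell2 set \<Rightarrow> bool"
  where [code del]: "open_ell2 U = (\<forall>h\<in>U. \<forall>\<^sub>F (h', g) in uniformity. h' = h \<longrightarrow> g \<in> U)"

instance
proof
  fix h g k :: "'a ell2" and r :: real and c d :: complex
  show "h + g + k = h + (g + k)" "h + g = g + h" "0 + h = h" "- h + h = 0" "h - g = h + - g"
    by (transfer; simp add: fun_eq_iff add.assoc add.commute)+
  show "r *\<^sub>R (h + g) = r *\<^sub>R h + r *\<^sub>R g" "1 *\<^sub>R h = h"
    by (transfer; simp add: scaleR_add_right)+
  show "(r + s) *\<^sub>R h = r *\<^sub>R h + s *\<^sub>R h" "r *\<^sub>R s *\<^sub>R h = (r * s) *\<^sub>R h" for s :: real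
    by (transfer; simp add: scaleR_add_left)+
  show "c *\<^sub>C (h + g) = c *\<^sub>C h + c *\<^sub>C g" "(c + d) *\<^sub>C h = c *\<^sub>C h + d *\<^sub>C h"
    "c *\<^sub>C d *\<^sub>C h = (c * d) *\<^sub>C h" "1 *\<^sub>C h = h" "r *\<^sub>R h = complex_of_real r *\<^sub>C h"
    by (transfer; simp add: scaleC_add_left scaleC_add_right scaleC_scaleC scaleC_one
        scaleR_scaleC)+
  show "dist h g = norm (h - g)" "sgn h = inverse (norm h) *\<^sub>R h"
    "(uniformity :: ('a ell2 \<times> 'a ell2) filter) = (INF e\<in>{0<..}. principal {(h, g). dist h g < e})"
    "open U = (\<forall>h\<in>U. \<forall>\<^sub>F (h', g) in uniformity. h' = h \<longrightarrow> g \<in> U)" for U :: "'a ell2 set"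
    by (simp_all add: dist_ell2_def sgn_ell2_def uniformity_ell2_def open_ell2_def)
  show "norm h = 0 \<longleftrightarrow> h = 0"
  proof (transfer, safe)
    fix h :: "int \<Rightarrow> 'a"
    assume h: "(\<lambda>i. (norm (h i))\<^sup>2) summable_on UNIV" "sqrt (\<Sum>\<^sub>\<infinity>i. (norm (h i))\<^sup>2) = 0"
    have "norm (h i) \<le> 0" for i
      using ell2_L2_set_le[OF h(1), of "{i}"] h(2) by simp
    then show "h = (\<lambda>_. 0)"
      by (simp add: fun_eq_iff)
  qed simp
  show "norm (h + g) \<le> norm h + norm g"
    by transfer (rule ell2_add)
  show "norm (r *\<^sub>R h) = \<bar>r\<bar> * norm h"
    by transfer (simp add: power_mult_distrib infsum_cmult_right' real_sqrt_mult)
  show "cinner h g = cnj (cinner g h)"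
    by transfer (simp add: infsum_cnj[symmetric] cinner_commute[symmetric])
  show "cinner (h + g) k = cinner h k + cinner g k"
    by transfer (simp add: cinner_add_left infsum_add ell2_cinner_summable)
  show "cinner (c *\<^sub>C h) g = c * cinner h g"
    by transfer (simp add: cinner_scaleC_left infsum_cmult_right')
  show "cinner h h = complex_of_real ((norm h)\<^sup>2)"
  proof transfer
    fix h :: "int \<Rightarrow> 'a"
    assume "(\<lambda>i. (norm (h i))\<^sup>2) summable_on UNIV"
    from infsumI[OF has_sum_of_real[OF has_sum_infsum[OF this]]]
    show "(\<Sum>\<^sub>\<infinity>i. cinner (h i) (h i))
        = complex_of_real ((sqrt (\<Sum>\<^sub>\<infinity>i. (norm (h i))\<^sup>2))\<^sup>2)"
      by (simp add: cinner_self infsum_nonneg)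
  qed
qed

end

lemma norm_ell2_nth_le: "norm (ell2_nth h i) \<le> norm h"
proof transfer
  fix h :: "int \<Rightarrow> 'a" and i
  assume "(\<lambda>i. (norm (h i))\<^sup>2) summable_on UNIV"
  from ell2_L2_set_le[OF this, of "{i}"]
  show "norm (h i) \<le> sqrt (\<Sum>\<^sub>\<infinity>i. (norm (h i))\<^sup>2)" by simp
qed

lemma L2_set_ell2_nth_le: "L2_set (\<lambda>i. norm (ell2_nth h i)) F \<le> norm h"
  by transfer (rule ell2_L2_set_le)

instance ell2 :: (complex_hilbert) complex_hilbert
proof
  fix X :: "nat \<Rightarrow> 'a ell2"
  assume X: "Cauchy X"
  have nth_diff: "ell2_nth (h - g) i = ell2_nth h i - ell2_nth g i" for h g :: "'a ell2" and i
    by transfer simp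
  have "\<exists>l. (\<lambda>n. ell2_nth (X n) i) \<longlonglongrightarrow> l" for i
  proof -
    have "Cauchy (\<lambda>n. ell2_nth (X n) i)"
    proof (rule metric_CauchyI)
      fix e :: real assume "0 < e"
      then obtain M where M: "\<And>m n. m \<ge> M \<Longrightarrow> n \<ge> M \<Longrightarrow> dist (X m) (X n) < e"
        using metric_CauchyD[OF X] by blast
      have "dist (ell2_nth (X m) i) (ell2_nth (X n) i) < e" if "m \<ge> M" "n \<ge> M" for m n
        using M[OF that] norm_ell2_nth_le[of "X m - X n" i]
        by (simp add: dist_norm nth_diff)
      then show "\<exists>M. \<forall>m\<ge>M. \<forall>n\<ge>M. dist (ell2_nth (X m) i) (ell2_nth (X n) i) < e"
        by blast
    qed
    then show ?thesis
      by (simp add: Cauchy_convergent_iff convergent_def)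
  qed
  then obtain l where l: "\<And>i. (\<lambda>n. ell2_nth (X n) i) \<longlonglongrightarrow> l i"
    by metis
  have bound: "\<exists>M. \<forall>m\<ge>M. \<forall>F. finite F \<longrightarrow> L2_set (\<lambda>i. norm (ell2_nth (X m) i - l i)) F \<le> e"
    if e: "0 < e" for e
  proof -
    obtain M where M: "\<And>m n. m \<ge> M \<Longrightarrow> n \<ge> M \<Longrightarrow> dist (X m) (X n) < e"
      using metric_CauchyD[OF X e] by blast
    have "L2_set (\<lambda>i. norm (ell2_nth (X m) i - l i)) F \<le> e" if m: "m \<ge> M" and "finite F" for m F
    proof (rule tendsto_upperbound)
      show "(\<lambda>n. L2_set (\<lambda>i. norm (ell2_nth (X m) i - ell2_nth (X n) i)) F)
          \<longlonglongrightarrow> L2_set (\<lambda>i. norm (ell2_nth (X m) i - l i)) F"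
        unfolding L2_set_def by (intro tendsto_intros l)
      show "\<forall>\<^sub>F n in sequentially.
          L2_set (\<lambda>i. norm (ell2_nth (X m) i - ell2_nth (X n) i)) F \<le> e"
        using eventually_ge_at_top[of M]
      proof eventually_elim
        case (elim n)
        show ?case
          using M[OF m elim] L2_set_ell2_nth_le[of "X m - X n" F]
          by (simp add: dist_norm nth_diff)
      qed
    qed simp
    then show ?thesis by blast
  qed
  obtain M where M: "\<And>F. finite F \<Longrightarrow> L2_set (\<lambda>i. norm (ell2_nth (X M) i - l i)) F \<le> 1"
    using bound[of 1] by auto
  have "(\<lambda>i. (norm (ell2_nth (X M) i + - (ell2_nth (X M) i - l i)))\<^sup>2) summable_on UNIV"
    using ell2_L2_set_bound(1)[OF M] ell2_nth[of "X M"]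
    by (intro ell2_add(1)) (simp_all add: norm_minus_commute)
  then have l_in: "(\<lambda>i. (norm (l i))\<^sup>2) summable_on UNIV"
    by simp
  define L where "L = Abs_ell2 l"
  have L: "ell2_nth L = l"
    unfolding L_def using l_in by (simp add: Abs_ell2_inverse)
  have "X \<longlonglongrightarrow> L"
  proof (rule metric_LIMSEQ_I)
    fix e :: real assume "0 < e"
    then obtain M where M: "\<And>m F. m \<ge> M \<Longrightarrow> finite F \<Longrightarrow>
        L2_set (\<lambda>i. norm (ell2_nth (X m) i - l i)) F \<le> e / 2"
      using bound[of "e / 2"] by auto
    have "dist (X m) L < e" if "m \<ge> M" for m
    proof -
      have "norm (X m - L) \<le> e / 2"
        using ell2_L2_set_bound(2)[OF M[OF that]]
        by (simp add: norm_ell2.rep_eq nth_diff L)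
      then show ?thesis
        using \<open>0 < e\<close> by (simp add: dist_norm)
    qed
    then show "\<exists>M. \<forall>m\<ge>M. dist (X m) L < e" by blast
  qed
  then show "convergent X"
    by (auto simp: convergent_def)
qed

definition bilateral_weighted_shift ::
    "(int \<Rightarrow> 'a :: complex_hilbert bop) \<Rightarrow> 'a ell2 bop \<Rightarrow> bool" where
  "bilateral_weighted_shift W S \<longleftrightarrow>
     bounded (range W) \<and> (\<forall>h i. ell2_nth (bop_apply S h) i = bop_apply (W i) (ell2_nth h (i - 1)))"

end

(* Let A_n = |S_n ... S_1|^2 for n >= 0 and A_{-n} = |S_{-n+1}* ... S_0*|^{-2} for n > 0.
   As S is m-isometric, the m-th differences of (A_n) vanish, so by Newton's formula A_n is an
   operator polynomial in n of degree < m. Hence A_0, ..., A_{m-1}, the whole family (A_n), and the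
   coefficients of the polynomial have the same commutant. An operator in it commutes with all S_n:
   inductively S_{n+1}^2 = (S_1 ... S_n)^{-1} A_{n+1} (S_n ... S_1)^{-1}, and S_{n+1} is the positive
   root of its square; likewise downwards. If the A_n commute, apply this first to the A_n and then
   to the S_n, which are now known to lie in the commutant. *)

theory Submission
  imports Defs
begin

section \<open>Forward differences on the integers, Newton's formula, uniqueness of polynomial
  coefficients\<close>

section \<open>Finite differences\<close>

definition fdiff :: "(int \<Rightarrow> 'a::real_vector) \<Rightarrow> int \<Rightarrow> 'a" where
  "fdiff f n = f (n + 1) - f n"

text \<open>Induction by Pascal's rule. The sum has the shape of the one defining an m-isometry, so
  that condition can be read as the vanishing of an \<open>m\<close>-th difference.\<close>

lemma funpow_fdiff_eq_sum:
  "(fdiff ^^ m) f n = (\<Sum>k\<le>m. (of_nat (m choose k) * (- 1) ^ (m - k)) *\<^sub>R f (n + int k))"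
proof (induction m arbitrary: n)
  case (Suc m)
  let ?c = "\<lambda>m k. (of_nat (m choose k) * (- 1) ^ (m - k) :: real)"
  \<comment> \<open>At \<open>k = m\<close> the exponent \<open>m - Suc k\<close> truncates to 0,
    harmlessly, since \<open>m choose Suc m\<close> is 0.\<close>
  have c: "?c (Suc m) (Suc k) = ?c m k - ?c m (Suc k)" if "k \<le> m" for k
    using that
    by (cases "k = m") (auto simp: algebra_simps Suc_diff_Suc[symmetric] less_le binomial_eq_0)
  have "(\<Sum>k\<le>Suc m. ?c (Suc m) k *\<^sub>R f (n + int k))
      = ?c (Suc m) 0 *\<^sub>R f n + (\<Sum>k\<le>m. (?c m k - ?c m (Suc k)) *\<^sub>R f (n + int (Suc k)))"
    unfolding sum.atMost_Suc_shift
    by (intro arg_cong2[where f = "(+)"] sum.cong refl) (simp_all only: c atMost_iff, simp)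
  also have "\<dots> = (\<Sum>k\<le>m. ?c m k *\<^sub>R f (n + 1 + int k))
      - (?c m 0 *\<^sub>R f n + (\<Sum>k\<le>m. ?c m (Suc k) *\<^sub>R f (n + int (Suc k))))"
    by (simp add: scaleR_diff_left sum_subtractf algebra_simps)
  also have "?c m 0 *\<^sub>R f n + (\<Sum>k\<le>m. ?c m (Suc k) *\<^sub>R f (n + int (Suc k)))
      = (\<Sum>k\<le>Suc m. ?c m k *\<^sub>R f (n + int k))"
    by (simp only: sum.atMost_Suc_shift) simp
  also have "\<dots> = (\<Sum>k\<le>m. ?c m k *\<^sub>R f (n + int k))"
    by (simp add: binomial_eq_0)
  finally show ?case
    by (simp only: funpow.simps comp_apply fdiff_def[of "(fdiff ^^ m) f"] Suc.IH)
qed simp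

text \<open>The sum \<open>F\<close> agrees with \<open>f\<close> at 0 and, by the induction
  hypothesis for \<open>fdiff f\<close>, has the same first difference; so \<open>f - F\<close> is
  constant in both directions. The generalised binomial coefficient covers negative
  arguments.\<close>

lemma newton_forward_difference:
  assumes "\<And>n. (fdiff ^^ m) f n = 0"
  shows "f n = (\<Sum>j<m. ((of_int n :: real) gchoose j) *\<^sub>R (fdiff ^^ j) f 0)"
  using assms
proof (induction m arbitrary: f n)
  case (Suc m)
  define F where "F n = (\<Sum>j<Suc m. ((of_int n :: real) gchoose j) *\<^sub>R (fdiff ^^ j) f 0)" for n
  have F: "F n = f 0 + (\<Sum>j<m. ((of_int n :: real) gchoose Suc j) *\<^sub>R (fdiff ^^ Suc j) f 0)" for n
    unfolding F_def by (subst sum.lessThan_Suc_shift) simp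
  have "F (n + 1) - F n = fdiff f n" for n
  proof -
    have "F (n + 1) - F n = (\<Sum>j<m. ((of_int n :: real) gchoose j) *\<^sub>R (fdiff ^^ Suc j) f 0)"
      by (simp add: F sum_subtractf[symmetric] scaleR_diff_left[symmetric] gbinomial_Suc_Suc
          del: funpow.simps)
    also have "\<dots> = fdiff f n"
      using Suc.prems by (subst Suc.IH[of "fdiff f"]) (simp_all add: funpow_swap1)
    finally show ?thesis .
  qed
  then have step: "f (n + 1) - F (n + 1) = f n - F n" for n
    by (simp add: fdiff_def algebra_simps) (metis add.commute add_diff_cancel_left' diff_add_eq)
  have "f n - F n = 0"
  proof (induction n rule: int_induct[of _ 0])
    case (step2 i)
    then show ?case using step[of "i - 1"] by simp
  next
    case (step1 i)
    then show ?case using step[of i] by simp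
  qed (simp add: F)
  then show ?case by (simp add: F_def)
qed simp

text \<open>The falling factorial divided by \<open>fact j\<close>, expanded in powers of
  \<open>x\<close>, so that Newton's formula can be rewritten as an ordinary polynomial.\<close>

lemma gbinomial_eq_polynomial:
  "\<exists>c. \<forall>x. (x :: real) gchoose j = (\<Sum>i\<le>j. c i * x ^ i)"
proof -
  define q where "q = smult (1 / fact j) (\<Prod>i<j. [:- real i, 1:])"
  have "degree (\<Prod>i<j. [:- real i, 1:]) \<le> (\<Sum>i<j. degree [:- real i, 1:])"
    using degree_prod_sum_le[of "{..<j}" "\<lambda>i. [:- real i, 1:]"] by (simp add: o_def)
  then have "degree q \<le> j"
    by (simp add: q_def)
  then have "poly q x = (\<Sum>i\<le>j. coeff q i * x ^ i)" for x
    unfolding poly_altdef by (intro sum.mono_neutral_left) (auto simp: coeff_eq_0)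
  moreover have "poly q x = x gchoose j" for x
    by (simp add: q_def poly_prod gbinomial_prod_rev atLeast0LessThan)
  ultimately show ?thesis by metis
qed

lemma polynomial_of_fdiff_eq_0:
  assumes "\<And>n. (fdiff ^^ m) f n = 0"
  shows "\<exists>a. \<forall>n. f n = (\<Sum>i<m. (of_int n :: real) ^ i *\<^sub>R a i)"
proof -
  obtain c where c: "\<And>j x. (x :: real) gchoose j = (\<Sum>i\<le>j. c j i * x ^ i)"
    using gbinomial_eq_polynomial by metis
  \<comment> \<open>Padding with zeros gives all \<open>j < m\<close> the same range of exponents,
    so that the two sums can be exchanged.\<close>
  define d where "d j i = (if i \<le> j then c j i else 0)" for j i
  have d: "(x :: real) gchoose j = (\<Sum>i<m. d j i * x ^ i)" if "j < m" for x j
    unfolding c d_def using that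
    by (intro sum.mono_neutral_cong_left) auto
  have "f n = (\<Sum>i<m. (of_int n :: real) ^ i *\<^sub>R (\<Sum>j<m. d j i *\<^sub>R (fdiff ^^ j) f 0))" for n
  proof -
    have "f n = (\<Sum>j<m. \<Sum>i<m. (d j i * of_int n ^ i) *\<^sub>R (fdiff ^^ j) f 0)"
      by (subst newton_forward_difference[OF assms]) (simp add: d scaleR_sum_left)
    also have "\<dots> = (\<Sum>i<m. \<Sum>j<m. (d j i * of_int n ^ i) *\<^sub>R (fdiff ^^ j) f 0)"
      by (rule sum.swap)
    finally show ?thesis
      by (simp add: scaleR_sum_right mult.commute)
  qed
  then show ?thesis by (intro exI allI)
qed

text \<open>Reduction to scalars: an algebraic linear functional taking the value 1 at a nonzero
  \<open>v j\<close> would turn the sum into a nonzero real polynomial with infinitely many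
  roots.\<close>

lemma polynomial_coeffs_eq_0:
  fixes v :: "nat \<Rightarrow> 'a::real_vector"
  assumes "\<And>n::nat. n \<ge> 1 \<Longrightarrow> (\<Sum>i\<le>d. real n ^ i *\<^sub>R v i) = 0" and "j \<le> d"
  shows "v j = 0"
proof (rule ccontr)
  assume "v j \<noteq> 0"
  then have "independent {v j}"
    by (simp add: dependent_single)
  then obtain g :: "'a \<Rightarrow> real" where g: "linear g" "g (v j) = 1"
    using linear_independent_extend[of "{v j}" "\<lambda>_. 1"] by auto
  have "g (\<Sum>i\<le>d. x ^ i *\<^sub>R v i) = (\<Sum>i\<le>d. g (v i) * x ^ i)" for x
    using g(1) by (simp add: linear_sum linear_cmul mult.commute)
  then have "(\<Sum>i\<le>d. g (v i) * real n ^ i) = 0" if "n \<ge> 1" for n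
    using assms(1)[OF that] linear_0[OF g(1)] by metis
  then have "real ` {1..} \<subseteq> {x. (\<Sum>i\<le>d. g (v i) * x ^ i) = 0}"
    by auto
  moreover have "finite {x. (\<Sum>i\<le>d. g (v i) * x ^ i) = 0}"
    using polyfun_finite_roots[of "\<lambda>i. g (v i)" d] g(2) assms(2)
    by (metis zero_neq_one)
  ultimately have "finite (real ` {1..})"
    by (rule finite_subset)
  then show False
    by (simp add: finite_image_iff infinite_Ici)
qed

lemma commute_sum_scaleR:
  fixes x :: "'a::real_algebra"
  assumes "\<And>j. j \<in> I \<Longrightarrow> x * g j = g j * x"
  shows "x * (\<Sum>j\<in>I. r j *\<^sub>R g j) = (\<Sum>j\<in>I. r j *\<^sub>R g j) * x"
  using assms by (simp add: sum_distrib_left sum_distrib_right)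

text \<open>Differences at 0 of order below \<open>m\<close> are combinations of the values at 0,
  ..., \<open>m - 1\<close>, and Newton's formula builds every value from them. This carries
  commutation from a finite window to all integers.\<close>

lemma commute_of_fdiff_eq_0:
  fixes x :: "'a::real_algebra"
  assumes "\<And>n. (fdiff ^^ m) f n = 0" and "\<And>k. k < m \<Longrightarrow> x * f (int k) = f (int k) * x"
  shows "x * f n = f n * x"
proof -
  have "x * (fdiff ^^ j) f 0 = (fdiff ^^ j) f 0 * x" if "j < m" for j
    unfolding funpow_fdiff_eq_sum using that by (intro commute_sum_scaleR) (simp add: assms(2))
  then show ?thesis
    unfolding newton_forward_difference[OF assms(1), of n] by (intro commute_sum_scaleR) simp
qed

section \<open>Noncommutative products in both orders, their inverses and commutants\<close>

section \<open>Ordered products\<close>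

text \<open>Two mirror orders are kept, \<open>f (n - 1)\<close> down to \<open>f 0\<close> here and
  the reverse in \<open>rprod\<close>, because adjoints and inverses reverse products.\<close>

primrec lprod :: "(nat \<Rightarrow> 'a::monoid_mult) \<Rightarrow> nat \<Rightarrow> 'a" where
  "lprod f 0 = 1"
| "lprod f (Suc n) = f n * lprod f n"

primrec rprod :: "(nat \<Rightarrow> 'a::monoid_mult) \<Rightarrow> nat \<Rightarrow> 'a" where
  "rprod f 0 = 1"
| "rprod f (Suc n) = rprod f n * f n"

lemma lprod_rprod_inverse:
  assumes "\<And>k. f k * g k = 1"
  shows "lprod f n * rprod g n = 1"
proof (induction n)
  case (Suc n)
  have "lprod f (Suc n) * rprod g (Suc n) = f n * (lprod f n * rprod g n) * g n"
    by (simp add: mult.assoc)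
  then show ?case by (simp add: Suc assms)
qed simp

lemma rprod_lprod_inverse:
  assumes "\<And>k. f k * g k = 1"
  shows "rprod f n * lprod g n = 1"
proof (induction n)
  case (Suc n)
  have "rprod f (Suc n) * lprod g (Suc n) = rprod f n * (f n * g n) * lprod g n"
    by (simp add: mult.assoc)
  then show ?case by (simp add: Suc assms)
qed simp

lemma commute_mult:
  fixes x :: "'a::semigroup_mult"
  assumes "x * y = y * x" "x * z = z * x"
  shows "x * (y * z) = (y * z) * x"
  by (metis assms mult.assoc)

lemma commute_lprod:
  assumes "\<And>k. k < n \<Longrightarrow> x * f k = f k * x"
  shows "x * lprod f n = lprod f n * x"
  using assms by (induction n) (auto intro!: commute_mult)

lemma commute_rprod:
  assumes "\<And>k. k < n \<Longrightarrow> x * f k = f k * x"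
  shows "x * rprod f n = rprod f n * x"
  using assms by (induction n) (auto intro!: commute_mult)

lemma commute_inverse:
  fixes x :: "'a::monoid_mult"
  assumes "x * y = y * x" "y * z = 1" "z * y = 1"
  shows "x * z = z * x"
proof -
  have "x * z = z * (y * x) * z" using assms by (simp add: mult.assoc[symmetric])
  also have "\<dots> = z * x" using assms(2) by (simp add: assms(1)[symmetric] mult.assoc)
  finally show ?thesis .
qed

lemma prod_list_rev_upto: "prod_list (map f (rev [1..int n])) = lprod (\<lambda>k. f (1 + int k)) n"
  by (induction n) (simp_all add: upto_rec2)

text \<open>Writing indices as \<open>- k\<close>, the ascending list runs from
  \<open>k = n - 1\<close> down to \<open>k = 0\<close>, which is the order of
  \<open>lprod\<close>.\<close>

lemma prod_list_upto_0: "prod_list (map f [- int n + 1..0]) = lprod (\<lambda>k. f (- int k)) n"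
proof (induction n)
  case (Suc n)
  have "[- int (Suc n) + 1..0] = - int n # [- int n + 1..0]"
    by (subst upto_rec1) auto
  then show ?case
    using Suc by simp
qed simp

section \<open>Bounded operators as a Banach algebra\<close>

section \<open>The algebra of bounded operators\<close>

lemma bop_eqI: "(\<And>x. bop_apply T x = bop_apply R x) \<Longrightarrow> T = R"
  by (metis bop_apply_inverse ext)

lemma bounded_linear_bop_apply: "bounded_linear (bop_apply T)"
  using bop_apply[of T] by simp

lemma linear_bop_apply: "linear (bop_apply T)"
  by (rule bounded_linear.linear[OF bounded_linear_bop_apply])

lemma bop_apply_scaleC: "bop_apply T (c *\<^sub>C x) = c *\<^sub>C bop_apply T x"
  using bop_apply[of T] by simp

lemmas bop_apply_rep_simps =
  plus_bop.rep_eq minus_bop.rep_eq zero_bop.rep_eq one_bop.rep_eq times_bop.rep_eq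
  scaleR_bop.rep_eq scaleC_bop.rep_eq

lemma bop_apply_sum: "bop_apply (\<Sum>i\<in>I. T i) x = (\<Sum>i\<in>I. bop_apply (T i) x)"
  by (induction I rule: infinite_finite_induct) (auto simp: bop_apply_rep_simps)

lemma norm_bop_apply: "norm (bop_apply T x) \<le> norm T * norm x"
  unfolding norm_bop.rep_eq by (rule onorm[OF bounded_linear_bop_apply])

lemma norm_bop_le: "0 \<le> b \<Longrightarrow> (\<And>x. norm (bop_apply T x) \<le> b * norm x) \<Longrightarrow> norm T \<le> b"
  unfolding norm_bop.rep_eq by (rule onorm_bound)

instance bop :: (complex_inner) real_normed_algebra
proof
  fix T R :: "'a bop" and r :: real
  show "r *\<^sub>R T * R = r *\<^sub>R (T * R)"
    by (rule bop_eqI) (simp add: bop_apply_rep_simps)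
  show "T * r *\<^sub>R R = r *\<^sub>R (T * R)"
    by (rule bop_eqI) (simp add: bop_apply_rep_simps linear_cmul[OF linear_bop_apply])
  show "norm (T * R) \<le> norm T * norm R"
    unfolding norm_bop.rep_eq times_bop.rep_eq
    using onorm_compose[OF bounded_linear_bop_apply bounded_linear_bop_apply, of T R]
    by (simp add: comp_def)
qed

text \<open>Limits are taken in the complete space of real-linear bounded operators; complex
  linearity survives because it passes to pointwise limits. Completeness is what the fixed-point
  construction of square roots rests on.\<close>

instance bop :: (complex_hilbert) banach
proof
  fix X :: "nat \<Rightarrow> 'a bop"
  assume X: "Cauchy X"
  define Y where "Y n = Blinfun (bop_apply (X n))" for n
  have Y: "blinfun_apply (Y n) = bop_apply (X n)" for n
    unfolding Y_def by (rule bounded_linear_Blinfun_apply[OF bounded_linear_bop_apply])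
  have dist_Y: "dist (Y n) (Y k) = dist (X n) (X k)" for n k
    unfolding dist_norm norm_bop.rep_eq norm_blinfun.rep_eq
    by (simp add: minus_bop.rep_eq minus_blinfun.rep_eq Y)
  have "Cauchy Y"
    using X by (simp add: Cauchy_def dist_Y)
  then obtain L where L: "Y \<longlonglongrightarrow> L"
    by (auto simp: Cauchy_convergent_iff convergent_def)
  have pt: "(\<lambda>n. bop_apply (X n) x) \<longlonglongrightarrow> blinfun_apply L x" for x
    using blinfun.tendsto[OF L tendsto_const] by (simp add: Y)
  have "blinfun_apply L (c *\<^sub>C x) = c *\<^sub>C blinfun_apply L x" for c x
  proof (rule LIMSEQ_unique[OF pt])
    show "(\<lambda>n. bop_apply (X n) (c *\<^sub>C x)) \<longlonglongrightarrow> c *\<^sub>C blinfun_apply L x"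
      unfolding bop_apply_scaleC by (rule bounded_linear.tendsto[OF bounded_linear_scaleC pt])
  qed
  then have "blinfun_apply L \<in> {T. bounded_linear T \<and> (\<forall>c x. T (c *\<^sub>C x) = c *\<^sub>C T x)}"
    by (simp add: blinfun.bounded_linear_right)
  then have L': "bop_apply (Abs_bop (blinfun_apply L)) = blinfun_apply L"
    by (rule Abs_bop_inverse)
  have "dist (X n) (Abs_bop (blinfun_apply L)) = dist (Y n) L" for n
    unfolding dist_norm norm_bop.rep_eq norm_blinfun.rep_eq
    by (simp add: minus_bop.rep_eq minus_blinfun.rep_eq Y L')
  then have "X \<longlonglongrightarrow> Abs_bop (blinfun_apply L)"
    using L by (simp add: lim_sequentially)
  then show "convergent X"
    by (auto simp: convergent_def)
qed

section \<open>Adjoint pairs and self-adjointness of positive operators\<close>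

section \<open>Adjoints\<close>

text \<open>A relation in place of the description \<open>adj\<close>: each adjoint that occurs is
  exhibited explicitly, so Riesz representation is not invoked.\<close>

definition adjoints :: "'a::complex_inner bop \<Rightarrow> 'a bop \<Rightarrow> bool" where
  "adjoints T R \<longleftrightarrow> (\<forall>x y. cinner (bop_apply T x) y = cinner x (bop_apply R y))"

lemma cinner_diff_left: "cinner (x - y) z = cinner x z - cinner y z"
  by (metis add_diff_cancel cinner_add_left diff_add_cancel)

lemma cinner_diff_right: "cinner x (y - z) = cinner x y - cinner x z"
  by (metis add_diff_cancel cinner_add_right diff_add_cancel)

lemma cinner_scaleR_right: "cinner x (r *\<^sub>R y) = complex_of_real r * cinner x y"
  by (simp add: scaleR_scaleC cinner_scaleC_right)

lemma cinner_self_eq_0: "cinner x x = 0 \<longleftrightarrow> x = 0"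
  by (simp add: cinner_self)

lemma cinner_0_left [simp]: "cinner 0 y = 0"
  using cinner_diff_left[of 0 0 y] by simp

lemma cinner_0_right [simp]: "cinner y 0 = 0"
  using cinner_diff_right[of y 0 0] by simp

text \<open>A weak Cauchy-Schwarz inequality, from scaling both vectors to norm 1; the factor 2 is
  good enough for continuity of the inner product.\<close>

lemma norm_cinner_le_mult: "norm (cinner x y) \<le> 2 * norm x * norm y"
proof (cases "x = 0 \<or> y = 0")
  case False
  have "norm (cinner ((1 / norm x) *\<^sub>R x) ((1 / norm y) *\<^sub>R y)) \<le> 2"
    using norm_cinner_le[of "(1 / norm x) *\<^sub>R x" "(1 / norm y) *\<^sub>R y"] False by simp
  then show ?thesis
    using False by (simp add: cinner_scaleR_left cinner_scaleR_right norm_mult norm_divide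
        divide_simps mult_ac)
qed auto

lemma bounded_linear_cinner_left: "bounded_linear (\<lambda>x. cinner x y)"
  by (rule bounded_linear_intro[where K = "2 * norm y"])
    (use norm_cinner_le_mult[of _ y] in
      \<open>auto simp: cinner_add_left cinner_scaleR_left scaleR_conv_of_real mult_ac\<close>)

lemma bounded_linear_cinner_right: "bounded_linear (\<lambda>y. cinner x y)"
  by (rule bounded_linear_intro[where K = "2 * norm x"])
    (use norm_cinner_le_mult[of x] in
      \<open>auto simp: cinner_add_right cinner_scaleR_right scaleR_conv_of_real mult_ac\<close>)

lemma adj_eqI:
  assumes "adjoints T R"
  shows "adj T = R"
  unfolding adj_def
proof (rule the_equality)
  show "\<forall>x y. cinner (bop_apply T x) y = cinner x (bop_apply R y)"
    using assms by (simp add: adjoints_def)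
next
  fix R' assume R': "\<forall>x y. cinner (bop_apply T x) y = cinner x (bop_apply R' y)"
  have "cinner x (bop_apply R' y - bop_apply R y) = 0" for x y
    using R' assms by (simp add: cinner_diff_right adjoints_def)
  then show "R' = R"
    by (intro bop_eqI) (metis cinner_self_eq_0 right_minus_eq)
qed

lemma adjoints_one: "adjoints 1 1"
  by (simp add: adjoints_def one_bop.rep_eq)

lemma adjoints_diff: "adjoints T T' \<Longrightarrow> adjoints R R' \<Longrightarrow> adjoints (T - R) (T' - R')"
  by (simp add: adjoints_def bop_apply_rep_simps cinner_diff_left cinner_diff_right)

lemma adjoints_add: "adjoints T T' \<Longrightarrow> adjoints R R' \<Longrightarrow> adjoints (T + R) (T' + R')"
  by (simp add: adjoints_def bop_apply_rep_simps cinner_add_left cinner_add_right)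

lemma adjoints_scaleR: "adjoints T T' \<Longrightarrow> adjoints (r *\<^sub>R T) (r *\<^sub>R T')"
  by (simp add: adjoints_def bop_apply_rep_simps cinner_scaleR_left cinner_scaleR_right)

lemma adjoints_mult: "adjoints T T' \<Longrightarrow> adjoints R R' \<Longrightarrow> adjoints (T * R) (R' * T')"
  by (simp add: adjoints_def bop_apply_rep_simps)

lemma adjoints_sym: "adjoints T R \<Longrightarrow> adjoints R T"
  unfolding adjoints_def by (metis cinner_commute)

lemma adjoints_lprod:
  assumes "\<And>k. adjoints (f k) (g k)"
  shows "adjoints (lprod f n) (rprod g n)"
  by (induction n) (auto simp: adjoints_one intro!: adjoints_mult assms)

text \<open>Polarization. The defect form \<open>B\<close> vanishes on the diagonal, hence is
  antisymmetric; replacing \<open>x\<close> by \<open>\<i> *\<^sub>C x\<close> makes it symmetric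
  too, because \<open>B\<close> is conjugate-linear in the second argument. So it is zero.\<close>

lemma op_pos_imp_self_adjoint:
  assumes "op_pos T"
  shows "adjoints T T"
proof -
  define B where "B x y = cinner (bop_apply T x) y - cinner x (bop_apply T y)" for x y
  have diag: "B x x = 0" for x
  proof -
    have "cinner (bop_apply T x) x \<in> \<real>"
      using assms by (cases "x = 0") (auto simp: op_pos_def)
    then show ?thesis
      unfolding B_def by (metis Reals_cnj_iff cinner_commute right_minus_eq)
  qed
  have swap: "B x y + B y x = 0" for x y
    using diag[of "x + y"] diag[of x] diag[of y]
    by (simp add: B_def linear_add[OF linear_bop_apply] cinner_add_left cinner_add_right
        algebra_simps)
  have "\<i> * B x y - \<i> * B y x = 0" for x y
    using swap[of "\<i> *\<^sub>C x" y]
    by (simp add: B_def bop_apply_scaleC cinner_scaleC_left cinner_scaleC_right algebra_simps)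
  then have "B x y = B y x" for x y
    by simp
  then have "B x y = 0" for x y
    using swap[of x y] by simp
  then show ?thesis
    by (simp add: adjoints_def B_def)
qed

lemma self_adjoint_cinner_real: "adjoints T T \<Longrightarrow> cinner (bop_apply T x) x \<in> \<real>"
  unfolding adjoints_def by (metis Reals_cnj_iff cinner_commute)

section \<open>Positive square roots by a contraction, and their commutation properties\<close>

section \<open>Square roots\<close>

lemma norm_diff_scaleR_sq:
  fixes x y :: "'a::complex_inner"
  shows "(norm (x - r *\<^sub>R y))\<^sup>2 = (norm x)\<^sup>2 - 2 * r * Re (cinner y x) + r\<^sup>2 * (norm y)\<^sup>2"
proof -
  have "(norm (x - r *\<^sub>R y))\<^sup>2 = Re (cinner (x - r *\<^sub>R y) (x - r *\<^sub>R y))"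
    by (simp add: cinner_self)
  also have "\<dots> = Re (cinner x x) - r * Re (cinner x y) - r * Re (cinner y x) + r * r * Re (cinner y y)"
    by (simp add: cinner_diff_left cinner_diff_right cinner_scaleR_left cinner_scaleR_right
        algebra_simps)
  also have "Re (cinner x y) = Re (cinner y x)"
    by (subst cinner_commute) simp
  finally show ?thesis
    by (simp add: cinner_self power2_eq_square)
qed

text \<open>The square root of \<open>1 - X\<close> with \<open>\<parallel>X\<parallel> < 1\<close> is \<open>1 - Y\<close> for the fixed point \<open>Y\<close>
  of \<open>Y \<mapsto> (X + Y\<^sup>2) / 2\<close>.\<close>

lemma op_root_exists:
  fixes T :: "'a::complex_hilbert bop"
  assumes adj: "adjoints T T'" and inv: "U * T = 1"
  obtains R where "op_nonneg R" "\<And>x. x \<noteq> 0 \<Longrightarrow> Re (cinner (bop_apply R x) x) > 0" "R ^ 2 = T' * T"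
    "\<And>C. C * (T' * T) = (T' * T) * C \<Longrightarrow> C * R = R * C"
proof -
  define A where "A = T' * T"
  \<comment> \<open>\<open>c\<close> dominates the squared norm of \<open>T'\<close> and
    \<open>u\<close> that of the left inverse \<open>U\<close>; they bound \<open>A\<close> from
    above and below. The added 1 keeps both away from 0.\<close>
  define c where "c = (norm T')\<^sup>2 + 1"
  define X where "X = 1 - (1 / c) *\<^sub>R A"
  define u where "u = (norm U)\<^sup>2 + 1"
  define q where "q = sqrt (1 - 1 / (c * u))"
  have c: "c \<ge> 1" and u: "u \<ge> 1"
    by (simp_all add: c_def u_def)
  then have cu: "c * u \<ge> 1"
    using mult_mono[of 1 c 1 u] by simp
  have q: "0 \<le> q" "q < 1" "q\<^sup>2 = 1 - 1 / (c * u)"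
    using cu by (auto simp: q_def)
  have "norm (bop_apply X x) \<le> q * norm x" for x
  proof (rule power2_le_imp_le)
    \<comment> \<open>The estimate is |Xx|^2 = |x|^2 - 2 t / c + |Ax|^2 / c^2 \<le> |x|^2 - t / c
      \<le> |x|^2 - |x|^2 / (c u).\<close>
    define t where "t = (norm (bop_apply T x))\<^sup>2"
    have "Re (cinner (bop_apply A x) x) = t"
      using adjoints_sym[OF adj]
      by (simp add: A_def t_def adjoints_def times_bop.rep_eq cinner_self)
    moreover have "(norm (bop_apply A x))\<^sup>2 \<le> c * t"
    proof -
      have "(norm (bop_apply A x))\<^sup>2 \<le> (norm T' * norm (bop_apply T x))\<^sup>2"
        by (intro power_mono) (auto simp: A_def times_bop.rep_eq norm_bop_apply)
      then show ?thesis
        by (simp add: c_def t_def power_mult_distrib distrib_right add_increasing2)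
    qed
    then have "(1 / c)\<^sup>2 * (norm (bop_apply A x))\<^sup>2 \<le> (1 / c)\<^sup>2 * (c * t)"
      by (rule mult_left_mono) simp
    moreover have "(1 / c)\<^sup>2 * (c * t) = t / c"
      using c by (simp add: power2_eq_square)
    moreover have "(norm x)\<^sup>2 \<le> u * t"
    proof -
      have "norm x = norm (bop_apply U (bop_apply T x))"
        using arg_cong[OF inv, of "\<lambda>R. bop_apply R x"] by (simp add: bop_apply_rep_simps)
      also have "\<dots> \<le> norm U * norm (bop_apply T x)"
        by (rule norm_bop_apply)
      finally have "(norm x)\<^sup>2 \<le> (norm U * norm (bop_apply T x))\<^sup>2"
        by (intro power_mono) auto
      then show ?thesis
        by (simp add: u_def t_def power_mult_distrib distrib_right add_increasing2)
    qed
    then have "(norm x)\<^sup>2 / (c * u) \<le> t / c"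
      using c u by (simp add: field_simps)
    moreover have "(norm (bop_apply X x))\<^sup>2 = (norm x)\<^sup>2 - 2 * (1 / c) * Re (cinner (bop_apply A x) x)
        + (1 / c)\<^sup>2 * (norm (bop_apply A x))\<^sup>2"
      unfolding X_def minus_bop.rep_eq one_bop.rep_eq scaleR_bop.rep_eq by (rule norm_diff_scaleR_sq)
    moreover have "(q * norm x)\<^sup>2 = (norm x)\<^sup>2 - (norm x)\<^sup>2 / (c * u)"
      by (simp add: power_mult_distrib q(3) left_diff_distrib)
    ultimately show "(norm (bop_apply X x))\<^sup>2 \<le> (q * norm x)\<^sup>2"
      by simp
  qed (simp add: q)
  then have X: "norm X \<le> q"
    by (rule norm_bop_le[OF q(1)])
  have A: "adjoints A A"
    unfolding A_def by (intro adjoints_mult adj adjoints_sym[OF adj])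
  \<comment> \<open>Self-adjointness and commutation with the commutant of \<open>A\<close> are
    closed conditions preserved by \<open>f\<close>; building them into \<open>s\<close> makes the
    fixed point inherit them.\<close>
  define s where "s = {Y. norm Y \<le> q \<and> adjoints Y Y \<and> (\<forall>C. C * A = A * C \<longrightarrow> C * Y = Y * C)}"
  define f where "f Y = (1 / 2) *\<^sub>R (X + Y * Y)" for Y
  have "bounded_linear (\<lambda>Y :: 'a bop. bop_apply Y x)" for x
    by (rule bounded_linear_intro[where K = "norm x"]) (auto simp: bop_apply_rep_simps norm_bop_apply)
  then have cont: "continuous_on UNIV (\<lambda>Y :: 'a bop. bop_apply Y x)" for x
    by (rule linear_continuous_on)
  have "closed s"
    unfolding s_def adjoints_def
    by (intro closed_Collect_conj closed_Collect_le closed_Collect_all closed_Collect_imp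
        closed_Collect_eq open_Collect_const continuous_intros
        bounded_linear.continuous_on[OF bounded_linear_cinner_left]
        bounded_linear.continuous_on[OF bounded_linear_cinner_right] cont)
  then have "complete s"
    by (simp add: complete_eq_closed)
  moreover have "s \<noteq> {}"
    using q(1) by (auto simp: s_def adjoints_def zero_bop.rep_eq intro!: exI[of _ 0])
  moreover have "f ` s \<subseteq> s"
  proof (intro image_subsetI)
    fix Y assume "Y \<in> s"
    then have Y: "norm Y \<le> q" "adjoints Y Y" "\<And>C. C * A = A * C \<Longrightarrow> C * Y = Y * C"
      by (auto simp: s_def)
    have "norm (Y * Y) \<le> q * q"
      by (rule order_trans[OF norm_mult_ineq]) (intro mult_mono Y norm_ge_zero q)
    also have "\<dots> \<le> q"
      using q mult_left_le[of q q] by simp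
    finally have "norm (f Y) \<le> q"
      using norm_triangle_ineq[of X "Y * Y"] X by (simp add: f_def)
    moreover have "adjoints (f Y) (f Y)"
      unfolding f_def X_def
      by (intro adjoints_scaleR adjoints_add adjoints_diff adjoints_one adjoints_mult A Y)
    moreover have "C * f Y = f Y * C" if "C * A = A * C" for C
      using commute_mult[OF Y(3)[OF that] Y(3)[OF that]] that
      by (simp add: f_def X_def algebra_simps)
    ultimately show "f Y \<in> s"
      by (simp add: s_def)
  qed
  moreover have "dist (f Y) (f Z) \<le> q * dist Y Z" if "Y \<in> s" "Z \<in> s" for Y Z
  proof -
    have YZ: "norm Y \<le> q" "norm Z \<le> q"
      using that by (auto simp: s_def)
    \<comment> \<open>This splitting of the difference of squares holds without commutation of
      \<open>Y\<close> and \<open>Z\<close>.\<close>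
    have "f Y - f Z = (1 / 2) *\<^sub>R (Y * (Y - Z) + (Y - Z) * Z)"
      by (simp add: f_def algebra_simps)
    then have "norm (f Y - f Z) \<le> (norm (Y * (Y - Z)) + norm ((Y - Z) * Z)) / 2"
      using norm_triangle_ineq[of "Y * (Y - Z)" "(Y - Z) * Z"] by simp
    also have "\<dots> \<le> (q * norm (Y - Z) + norm (Y - Z) * q) / 2"
      by (intro divide_right_mono add_mono order_trans[OF norm_mult_ineq] mult_mono YZ q) auto
    finally show ?thesis
      by (simp add: dist_norm mult.commute)
  qed
  ultimately have "\<exists>!Y\<in>s. f Y = Y"
    using q by (intro Banach_fix[of s q f]) auto
  then obtain Y where Y: "Y \<in> s" "f Y = Y" by auto
  \<comment> \<open>The fixed-point equation says that \<open>(1 - Y)\<close> squared is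
    \<open>1 - X\<close>, that is, \<open>A\<close> divided by \<open>c\<close>; the factor
    \<open>sqrt c\<close> undoes the scaling.\<close>
  define R where "R = sqrt c *\<^sub>R (1 - Y)"
  have Ys: "norm Y \<le> q" "adjoints Y Y" "\<And>C. C * A = A * C \<Longrightarrow> C * Y = Y * C"
    using Y(1) by (auto simp: s_def)
  have pos: "Re (cinner (bop_apply R x) x) > 0" if "x \<noteq> 0" for x
  proof -
    have "norm (bop_apply Y x) \<le> q * norm x"
      by (rule order_trans[OF norm_bop_apply mult_right_mono[OF Ys(1)]]) simp
    then have "(norm (bop_apply Y x))\<^sup>2 \<le> (q * norm x)\<^sup>2"
      by (intro power_mono) auto
    also have "\<dots> < (norm x)\<^sup>2"
      using that q mult_strict_right_mono[of q 1 "norm x"] by (intro power_strict_mono) auto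
    finally have "Re (cinner (bop_apply Y x) x) < (norm x)\<^sup>2"
      using Re_cinner_bound[of "bop_apply Y x" x] by simp
    then show ?thesis
      using c by (simp add: R_def bop_apply_rep_simps cinner_scaleR_left cinner_diff_left cinner_self)
  qed
  have "adjoints R R"
    unfolding R_def by (intro adjoints_scaleR adjoints_diff adjoints_one Ys)
  then have "op_nonneg R"
    unfolding op_nonneg_def
  proof (intro allI conjI)
    fix x
    show "0 \<le> Re (cinner (bop_apply R x) x)"
      using pos[of x] by (cases "x = 0") (auto simp: less_imp_le)
  qed (rule self_adjoint_cinner_real)
  moreover have "R ^ 2 = T' * T"
  proof -
    have "Y + Y = X + Y * Y"
      using arg_cong[OF Y(2), of "\<lambda>Z. 2 *\<^sub>R Z"] by (simp add: f_def scaleR_2)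
    then have "(1 - Y) * (1 - Y) = 1 - X"
      by (simp add: algebra_simps)
    then have "R ^ 2 = c *\<^sub>R (1 - X)"
      using c by (simp add: R_def power2_eq_square)
    then show ?thesis
      using c by (simp add: X_def A_def)
  qed
  moreover have "C * R = R * C" if "C * (T' * T) = (T' * T) * C" for C
    using Ys(3)[of C] that by (simp add: R_def A_def algebra_simps)
  ultimately show ?thesis
    using that pos by blast
qed

text \<open>\<open>R'\<close> commutes with its own square, hence with \<open>R\<close>. Then
  \<open>(R + R') * (R' - R) = 0\<close>, and \<open>R + R'\<close> is injective because
  \<open>R\<close> is strictly positive and \<open>R'\<close> nonnegative.\<close>

lemma op_root_unique:
  assumes R: "\<And>x. x \<noteq> 0 \<Longrightarrow> Re (cinner (bop_apply R x) x) > 0"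
    "\<And>C. C * R ^ 2 = R ^ 2 * C \<Longrightarrow> C * R = R * C"
    and R': "op_nonneg R'" "R' ^ 2 = R ^ 2"
  shows "R' = R"
proof (rule bop_eqI)
  fix x
  have "R' * R ^ 2 = R ^ 2 * R'"
    unfolding R'(2)[symmetric] by (simp add: power2_eq_square mult.assoc)
  then have "R' * R = R * R'"
    by (rule R(2))
  then have *: "(R + R') * (R' - R) = 0"
    using R'(2) by (simp add: algebra_simps power2_eq_square)
  define y where "y = bop_apply (R' - R) x"
  have "bop_apply R y + bop_apply R' y = 0"
    unfolding y_def using arg_cong[OF *, of "\<lambda>T. bop_apply T x"]
    by (simp add: bop_apply_rep_simps)
  then have "Re (cinner (bop_apply R y) y) + Re (cinner (bop_apply R' y) y) = 0"
    by (metis cinner_add_left cinner_0_left plus_complex.sel(1) zero_complex.sel(1))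
  moreover have "Re (cinner (bop_apply R' y) y) \<ge> 0"
    using R'(1) by (simp add: op_nonneg_def)
  ultimately have "y = 0"
    using R(1)[of y] by force
  then show "bop_apply R' x = bop_apply R x"
    by (simp add: y_def bop_apply_rep_simps)
qed

text \<open>The left inverse makes the constructed root strictly positive, so uniqueness identifies
  it with the root described by \<open>op_sqrt\<close>.\<close>

lemma op_abs_power2:
  assumes "adjoints T T'" "U * T = 1"
  shows "op_abs T ^ 2 = T' * T"
proof -
  obtain R where R: "op_nonneg R" "\<And>x. x \<noteq> 0 \<Longrightarrow> Re (cinner (bop_apply R x) x) > 0" "R ^ 2 = T' * T"
    "\<And>C. C * (T' * T) = (T' * T) * C \<Longrightarrow> C * R = R * C"
    using op_root_exists[OF assms] by blast
  have "op_sqrt (T' * T) = R"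
    unfolding op_sqrt_def
  proof (rule the_equality)
    fix R' assume "op_nonneg R' \<and> R' ^ 2 = T' * T"
    then show "R' = R"
      by (intro op_root_unique[OF R(2) R(4)[folded R(3)]]) (simp_all add: R(3))
  qed (simp add: R(1,3))
  then show ?thesis
    by (simp add: op_abs_def adj_eqI[OF assms(1)] R(3))
qed

text \<open>By uniqueness \<open>P\<close> is the constructed root of \<open>P * P\<close>, which
  commutes with everything that commutes with \<open>P * P\<close>.\<close>

lemma op_pos_commute_of_square:
  assumes "op_pos P" "op_invertible P" "C * (P * P) = (P * P) * C"
  shows "C * P = P * C"
proof -
  obtain U where U: "U * P = 1"
    using assms(2) by (auto simp: op_invertible_def)
  obtain R where R: "op_nonneg R" "\<And>x. x \<noteq> 0 \<Longrightarrow> Re (cinner (bop_apply R x) x) > 0" "R ^ 2 = P * P"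
    "\<And>C. C * (P * P) = (P * P) * C \<Longrightarrow> C * R = R * C"
    using op_root_exists[OF op_pos_imp_self_adjoint[OF assms(1)] U] by blast
  have "op_nonneg P"
    unfolding op_nonneg_def
  proof
    fix x
    show "cinner (bop_apply P x) x \<in> \<real> \<and> 0 \<le> Re (cinner (bop_apply P x) x)"
      using assms(1) by (cases "x = 0") (auto simp: op_pos_def less_imp_le)
  qed
  then have "P = R"
  proof (rule op_root_unique[of R, rotated 2])
    show "C * R = R * C" if "C * R\<^sup>2 = R\<^sup>2 * C" for C
      using that by (intro R(4)) (simp only: R(3))
    show "P\<^sup>2 = R\<^sup>2"
      by (simp only: R(3) power2_eq_square[of P])
  qed (rule R(2))
  then show ?thesis
    using R(4)[OF assms(3)] by simp
qed

section \<open>The m-isometry condition on a shift as identities between its weights\<close>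

section \<open>Weighted shifts\<close>

lemma ell2_eqI: "(\<And>i. ell2_nth h i = ell2_nth g i) \<Longrightarrow> h = g"
  by (metis ell2_nth_inverse ext)

lemma ell2_nth_sum: "ell2_nth (\<Sum>k\<in>I. h k) i = (\<Sum>k\<in>I. ell2_nth (h k) i)"
  by (induction I rule: infinite_finite_induct) (auto simp: zero_ell2.rep_eq plus_ell2.rep_eq)

lemma ell2_single: "\<exists>h. ell2_nth h i = x"
proof -
  define h where "h j = (if j = i then x else 0)" for j
  have "(\<lambda>j. (norm (h j))\<^sup>2) summable_on UNIV"
    by (rule finite_nonzero_values_imp_summable_on, rule finite_subset[of _ "{i}"])
      (auto simp: h_def)
  then have "ell2_nth (Abs_ell2 h) i = x"
    by (simp add: Abs_ell2_inverse h_def)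
  then show ?thesis ..
qed

text \<open>Provides the candidate for the adjoint of a forward shift. One bound on finite partial
  sums gives both square summability of the image and boundedness of the operator.\<close>

lemma backward_weighted_shift_exists:
  fixes V :: "int \<Rightarrow> 'a::complex_hilbert bop"
  assumes "bounded (range V)"
  shows "\<exists>R. \<forall>h i. ell2_nth (bop_apply R h) i = bop_apply (V i) (ell2_nth h (i + 1))"
proof -
  obtain M where M: "M > 0" "\<And>i. norm (V i) \<le> M"
    using assms by (auto simp: bounded_pos)
  define g where "g h = Abs_ell2 (\<lambda>i. bop_apply (V i) (ell2_nth h (i + 1)))" for h
  have bound: "L2_set (\<lambda>i. norm (bop_apply (V i) (ell2_nth h (i + 1)))) F \<le> M * norm h"
    for h and F :: "int set"
  proof -
    have "L2_set (\<lambda>i. norm (bop_apply (V i) (ell2_nth h (i + 1)))) F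
        \<le> L2_set (\<lambda>i. M * norm (ell2_nth h (i + 1))) F"
      by (intro L2_set_mono order_trans[OF norm_bop_apply] mult_right_mono M) auto
    also have "\<dots> = M * L2_set (\<lambda>i. norm (ell2_nth h i)) ((\<lambda>i. i + 1) ` F)"
      using M(1) by (simp add: L2_set_right_distrib[symmetric]) (simp add: L2_set_def sum.reindex)
    also have "\<dots> \<le> M * norm h"
      using M(1) by (intro mult_left_mono L2_set_ell2_nth_le) auto
    finally show ?thesis .
  qed
  have g: "ell2_nth (g h) i = bop_apply (V i) (ell2_nth h (i + 1))" for h i
    unfolding g_def using ell2_L2_set_bound(1)[OF bound] by (subst Abs_ell2_inverse) auto
  have "bounded_linear g"
  proof (rule bounded_linear_intro[where K = M])
    show "norm (g h) \<le> norm h * M" for h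
      unfolding norm_ell2.rep_eq[of "g h"] g using ell2_L2_set_bound(2)[OF bound]
      by (simp add: mult.commute)
  qed (auto intro!: ell2_eqI simp: g plus_ell2.rep_eq scaleR_ell2.rep_eq
      linear_add[OF linear_bop_apply] linear_cmul[OF linear_bop_apply])
  moreover have "g (c *\<^sub>C h) = c *\<^sub>C g h" for c h
    by (rule ell2_eqI) (simp add: g scaleC_ell2.rep_eq bop_apply_scaleC)
  ultimately have "bop_apply (Abs_bop g) = g"
    by (simp add: Abs_bop_inverse)
  then show ?thesis
    using g by metis
qed

text \<open>Shift the summation index by one; self-adjointness then moves each weight to the other
  argument.\<close>

lemma backward_weighted_shift_adjoint:
  fixes W :: "int \<Rightarrow> 'a::complex_hilbert bop"
  assumes S: "\<And>h i. ell2_nth (bop_apply S h) i = bop_apply (W i) (ell2_nth h (i - 1))"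
    and R: "\<And>h i. ell2_nth (bop_apply R h) i = bop_apply (W (i + 1)) (ell2_nth h (i + 1))"
    and W: "\<And>j. adjoints (W j) (W j)"
  shows "adjoints S R"
  unfolding adjoints_def
proof (intro allI)
  fix h g
  have "bij (\<lambda>i :: int. i + 1)"
    by (rule bij_betw_byWitness[where f' = "\<lambda>i. i - 1"]) auto
  from infsum_reindex_bij_betw[OF this,
      of "\<lambda>i. cinner (bop_apply (W i) (ell2_nth h (i - 1))) (ell2_nth g i)"]
  show "cinner (bop_apply S h) g = cinner h (bop_apply R g)"
    using W by (simp add: cinner_ell2.rep_eq S R adjoints_def)
qed

text \<open>The factors have indices \<open>i - k + 1\<close> to \<open>i\<close>. At coordinate
  \<open>i + k\<close> they are thus \<open>i + 1\<close> to \<open>i + k\<close>, the same as in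
  the backward power at coordinate \<open>i\<close>.\<close>

lemma weighted_shift_power:
  assumes "\<And>h i. ell2_nth (bop_apply S h) i = bop_apply (W i) (ell2_nth h (i - 1))"
  shows "ell2_nth (bop_apply (S ^ k) h) i
    = bop_apply (lprod (\<lambda>j. W (i - int k + 1 + int j)) k) (ell2_nth h (i - int k))"
proof (induction k arbitrary: i)
  case (Suc k)
  show ?case
    by (simp add: bop_apply_rep_simps assms Suc.IH algebra_simps)
qed (simp add: bop_apply_rep_simps)

lemma backward_weighted_shift_power:
  assumes "\<And>h i. ell2_nth (bop_apply R h) i = bop_apply (W (i + 1)) (ell2_nth h (i + 1))"
  shows "ell2_nth (bop_apply (R ^ k) h) i
    = bop_apply (rprod (\<lambda>j. W (i + 1 + int j)) k) (ell2_nth h (i + int k))"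
proof (induction k arbitrary: h)
  case (Suc k)
  show ?case
    \<comment> \<open>Peeling off the innermost factor matches \<open>rprod\<close>, which grows on
      the right; this is why \<open>h\<close> varies in the induction.\<close>
    unfolding power_Suc2 by (simp add: bop_apply_rep_simps assms Suc.IH algebra_simps)
qed (simp add: bop_apply_rep_simps)

text \<open>Each \<open>R ^ k * S ^ k\<close> is diagonal, so the operator identity can be read off
  coordinate by coordinate, on a sequence with an arbitrary entry \<open>x\<close> at
  \<open>i\<close>.\<close>

lemma m_isometric_weighted_shift:
  fixes W :: "int \<Rightarrow> 'a::complex_hilbert bop"
  assumes shift: "bilateral_weighted_shift W S" and isom: "m_isometric m S"
    and W: "\<And>j. adjoints (W j) (W j)"
  shows "(\<Sum>k\<le>m. (of_nat (m choose k) * (- 1) ^ (m - k)) *\<^sub>R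
    (rprod (\<lambda>j. W (i + 1 + int j)) k * lprod (\<lambda>j. W (i + 1 + int j)) k)) = 0"
proof (rule bop_eqI)
  fix x :: 'a
  have S: "ell2_nth (bop_apply S h) i = bop_apply (W i) (ell2_nth h (i - 1))" for h i
    using shift by (simp add: bilateral_weighted_shift_def)
  have "bounded (range (\<lambda>i. W (i + 1)))"
    by (rule bounded_subset[of "range W"]) (use shift in \<open>auto simp: bilateral_weighted_shift_def\<close>)
  then obtain R where
    R: "\<And>h i. ell2_nth (bop_apply R h) i = bop_apply (W (i + 1)) (ell2_nth h (i + 1))"
    using backward_weighted_shift_exists[of "\<lambda>i. W (i + 1)"] by blast
  have adj: "adj S = R"
    by (rule adj_eqI[OF backward_weighted_shift_adjoint[OF S R W]])
  have c: "of_nat (m choose k) * (- 1) ^ (m - k)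
      = complex_of_real (of_nat (m choose k) * (- 1) ^ (m - k))" for k
    by simp
  have 0: "(\<Sum>k\<le>m. (of_nat (m choose k) * (- 1) ^ (m - k)) *\<^sub>R (R ^ k * S ^ k)) = 0"
    using isom unfolding m_isometric_def adj c scaleR_scaleC .
  obtain h where h: "ell2_nth h i = x"
    using ell2_single by blast
  have "ell2_nth (bop_apply (\<Sum>k\<le>m. (of_nat (m choose k) * (- 1) ^ (m - k)) *\<^sub>R (R ^ k * S ^ k)) h) i = 0"
    unfolding 0 by (simp add: zero_bop.rep_eq zero_ell2.rep_eq)
  then show "bop_apply (\<Sum>k\<le>m. (of_nat (m choose k) * (- 1) ^ (m - k)) *\<^sub>R
    (rprod (\<lambda>j. W (i + 1 + int j)) k * lprod (\<lambda>j. W (i + 1 + int j)) k)) x = bop_apply 0 x"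
    by (simp add: bop_apply_sum ell2_nth_sum scaleR_bop.rep_eq times_bop.rep_eq scaleR_ell2.rep_eq
        backward_weighted_shift_power[OF R] weighted_shift_power[OF S] h zero_bop.rep_eq)
qed

section \<open>The two-sided moment sequence and recovery of the weights from it\<close>

section \<open>Moments\<close>

text \<open>A monoid suffices as setting: recovering weights from moments uses multiplication, the
  inverses \<open>V\<close>, and an abstract square-root hypothesis.\<close>

locale invertible_weights =
  fixes W V :: "int \<Rightarrow> 'a::monoid_mult"
  assumes W_V: "W j * V j = 1" and V_W: "V j * W j = 1"
begin

text \<open>\<open>left n\<close> is \<open>W\<^sub>n \<cdots> W\<^sub>1\<close>, continued to negative \<open>n\<close> by the recurrence \<open>left (n + 1) = W (n + 1) * left n\<close>.\<close>

definition left :: "int \<Rightarrow> 'a" where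
  "left n = (if n \<ge> 0 then lprod (\<lambda>k. W (1 + int k)) (nat n) else lprod (\<lambda>k. V (- int k)) (nat (- n)))"

definition right :: "int \<Rightarrow> 'a" where
  "right n = (if n \<ge> 0 then rprod (\<lambda>k. W (1 + int k)) (nat n) else rprod (\<lambda>k. V (- int k)) (nat (- n)))"

text \<open>For the weights of the theorem these are the prescribed values at \<open>n\<close> and
  at \<open>- n\<close>, joined into a single function on the integers so that differences can be
  taken across 0.\<close>

definition moment :: "int \<Rightarrow> 'a" where
  "moment n = right n * left n"

lemma moment_0: "moment 0 = 1"
  by (simp add: moment_def left_def right_def)

lemma
  shows left_step: "left (n + 1) = W (n + 1) * left n"
    and right_step: "right (n + 1) = right n * W (n + 1)"
proof -
  have "left (n + 1) = W (n + 1) * left n \<and> right (n + 1) = right n * W (n + 1)"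
  proof (cases "n \<ge> 0")
    case True
    then have "nat (n + 1) = Suc (nat n)" "1 + int (nat n) = n + 1"
      by auto
    with True show ?thesis
      by (simp add: left_def right_def add.commute)
  next
    case False
    \<comment> \<open>The outermost factor of \<open>left n\<close> is \<open>V (- int k)\<close>,
      which \<open>W (n + 1)\<close> cancels; likewise on the other side for
      \<open>right n\<close>.\<close>
    then obtain k where n: "n = - int (Suc k)"
      by (metis not_le int_cases2 negD)
    have *: "left (- int l) = lprod (\<lambda>k. V (- int k)) l" "right (- int l) = rprod (\<lambda>k. V (- int k)) l" for l
      by (cases l; simp add: left_def right_def del: of_nat_Suc)+
    have "n + 1 = - int k"
      by (simp add: n)
    then show ?thesis
      unfolding n by (simp only: *) (simp add: mult.assoc[symmetric] W_V, simp add: mult.assoc V_W)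
  qed
  then show "left (n + 1) = W (n + 1) * left n" "right (n + 1) = right n * W (n + 1)"
    by auto
qed

lemma left_add: "left (n + int k) = lprod (\<lambda>j. W (n + 1 + int j)) k * left n"
proof (induction k)
  case (Suc k)
  then show ?case
    using left_step[of "n + int k"] by (simp add: algebra_simps)
qed simp

lemma right_add: "right (n + int k) = right n * rprod (\<lambda>j. W (n + 1 + int j)) k"
proof (induction k)
  case (Suc k)
  then show ?case
    using right_step[of "n + int k"] by (simp add: algebra_simps)
qed simp

text \<open>The outer factors do not depend on \<open>k\<close>, so they can be pulled out of an
  \<open>m\<close>-th difference at \<open>n\<close>.\<close>

lemma moment_add:
  "moment (n + int k)
    = right n * (rprod (\<lambda>j. W (n + 1 + int j)) k * lprod (\<lambda>j. W (n + 1 + int j)) k) * left n"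
  by (simp add: moment_def left_add right_add mult.assoc)

lemma left_inverse: "\<exists>u. u * left n = 1 \<and> left n * u = 1"
proof (cases "n \<ge> 0")
  case True
  then show ?thesis
    using lprod_rprod_inverse[of "\<lambda>k. W (1 + int k)" "\<lambda>k. V (1 + int k)" "nat n"]
      rprod_lprod_inverse[of "\<lambda>k. V (1 + int k)" "\<lambda>k. W (1 + int k)" "nat n"]
    by (auto simp: left_def W_V V_W)
next
  case False
  then show ?thesis
    using lprod_rprod_inverse[of "\<lambda>k. V (- int k)" "\<lambda>k. W (- int k)" "nat (- n)"]
      rprod_lprod_inverse[of "\<lambda>k. W (- int k)" "\<lambda>k. V (- int k)" "nat (- n)"]
    by (auto simp: left_def W_V V_W)
qed

lemma right_inverse: "\<exists>u. u * right n = 1 \<and> right n * u = 1"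
proof (cases "n \<ge> 0")
  case True
  then show ?thesis
    using rprod_lprod_inverse[of "\<lambda>k. W (1 + int k)" "\<lambda>k. V (1 + int k)" "nat n"]
      lprod_rprod_inverse[of "\<lambda>k. V (1 + int k)" "\<lambda>k. W (1 + int k)" "nat n"]
    by (auto simp: right_def W_V V_W)
next
  case False
  then show ?thesis
    using rprod_lprod_inverse[of "\<lambda>k. V (- int k)" "\<lambda>k. W (- int k)" "nat (- n)"]
      lprod_rprod_inverse[of "\<lambda>k. W (- int k)" "\<lambda>k. V (- int k)" "nat (- n)"]
    by (auto simp: right_def W_V V_W)
qed

text \<open>Induction from \<open>left 0 = right 0 = 1\<close> in both directions: once
  \<open>x\<close> commutes with \<open>left n\<close> and \<open>right n\<close>, cancelling them
  from a neighbouring moment gives commutation with the square of the next weight or of its inverse,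
  and \<open>root\<close> removes the square.\<close>

lemma commute_weights_of_moments:
  assumes root: "\<And>j. x * (W j * W j) = (W j * W j) * x \<Longrightarrow> x * W j = W j * x"
    and moments: "\<And>n. x * moment n = moment n * x"
  shows "x * W j = W j * x"
proof -
  \<comment> \<open>The inverses of \<open>left n\<close> and \<open>right n\<close> also commute
    with \<open>x\<close>, so cancelling the outer factors of a moment stays within the
    commutant.\<close>
  have middle: "x * q = q * x"
    if "moment k = right n * q * left n" "x * left n = left n * x" "x * right n = right n * x" for k n q
  proof -
    obtain l where l: "l * left n = 1" "left n * l = 1" using left_inverse by blast
    obtain r where r: "r * right n = 1" "right n * r = 1" using right_inverse by blast
    have "r * moment k * l = (r * right n) * q * (left n * l)"
      by (simp only: that(1) mult.assoc)
    then have "q = r * moment k * l"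
      by (simp add: l r)
    then show ?thesis
      using commute_inverse[OF that(2) l(2,1)] commute_inverse[OF that(3) r(2,1)] moments[of k]
      by (simp add: commute_mult)
  qed
  have up: "x * W (n + 1) = W (n + 1) * x" if "x * left n = left n * x" "x * right n = right n * x" for n
    by (rule root, rule middle[OF _ that, of "n + 1"])
      (simp add: moment_def left_step right_step mult.assoc)
  \<comment> \<open>Downwards the middle factor is \<open>V n * V n\<close>; inverting it leads back
    to the square of \<open>W n\<close>.\<close>
  have down: "x * W n = W n * x" if "x * left n = left n * x" "x * right n = right n * x" for n
  proof (rule root)
    have step: "left (n - 1) = V n * left n" "right (n - 1) = right n * V n"
      using left_step[of "n - 1"] right_step[of "n - 1"]
      by (simp_all add: mult.assoc W_V) (simp add: mult.assoc[symmetric] V_W)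
    have "x * (V n * V n) = (V n * V n) * x"
      by (rule middle[OF _ that, of "n - 1"]) (simp add: moment_def step mult.assoc)
    moreover have "(V n * V n) * (W n * W n) = 1" "(W n * W n) * (V n * V n) = 1"
      by (metis V_W W_V mult.assoc mult_1_left)+
    ultimately show "x * (W n * W n) = (W n * W n) * x"
      by (rule commute_inverse)
  qed
  have "x * left n = left n * x \<and> x * right n = right n * x" for n
  proof (induction n rule: int_induct[of _ 0])
    case (step1 i)
    then show ?case
      using up[of i] by (simp add: left_step right_step commute_mult)
  next
    case (step2 i)
    have "x * V i = V i * x"
      using commute_inverse[OF _ W_V V_W] down step2 by blast
    moreover have "left (i - 1) = V i * left i" "right (i - 1) = right i * V i"
      using left_step[of "i - 1"] right_step[of "i - 1"]
      by (simp_all add: mult.assoc W_V) (simp add: mult.assoc[symmetric] V_W)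
    ultimately show ?case
      using step2 by (simp add: commute_mult)
  qed (simp add: left_def right_def)
  then show ?thesis
    using up[of "j - 1"] by simp
qed

text \<open>Up to \<open>k = m - 1\<close> only the weights of condition (ii) enter.\<close>

lemma commute_moment:
  assumes "\<And>j. j \<in> {1..int k} \<Longrightarrow> x * W j = W j * x"
  shows "x * moment (int k) = moment (int k) * x"
  unfolding moment_def left_def right_def
  by (auto intro!: commute_mult commute_lprod commute_rprod assms)

end

section \<open>Evaluation at integers and the commutant of the coefficients\<close>

section \<open>Operator polynomials\<close>

lemma op_poly_of_int:
  assumes "degree p \<le> d"
  shows "op_poly p (of_int n) = (\<Sum>j\<le>d. (of_int n :: real) ^ j *\<^sub>R coeff p j)"
proof -
  have "op_poly p (of_int n) = (\<Sum>j\<le>degree p. (of_int n :: real) ^ j *\<^sub>R coeff p j)"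
    by (simp add: op_poly_def scaleR_scaleC)
  also have "\<dots> = (\<Sum>j\<le>d. (of_int n :: real) ^ j *\<^sub>R coeff p j)"
    using assms by (intro sum.mono_neutral_left) (auto simp: coeff_eq_0)
  finally show ?thesis .
qed

text \<open>The commutators of \<open>x\<close> with the coefficients are the coefficients of a
  polynomial vanishing at every positive integer.\<close>

lemma commute_coeff_of_op_poly:
  assumes "\<And>n::nat. n \<ge> 1 \<Longrightarrow> x * op_poly p (of_nat n) = op_poly p (of_nat n) * x"
  shows "x * coeff p j = coeff p j * x"
proof (cases "j \<le> degree p")
  case True
  have "(\<Sum>i\<le>degree p. real n ^ i *\<^sub>R (x * coeff p i - coeff p i * x)) = 0" if "n \<ge> 1" for n
    using assms[OF that] op_poly_of_int[OF order.refl, of p "int n"]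
    by (simp add: sum_distrib_left sum_distrib_right scaleR_diff_right sum_subtractf)
  from polynomial_coeffs_eq_0[OF this True] show ?thesis
    by simp
qed (simp add: coeff_eq_0)

lemma op_inv_eqI:
  assumes "A * B = 1" "B * A = 1"
  shows "op_inv A = B"
  unfolding op_inv_def
proof (rule the_equality)
  show "B' = B" if "A * B' = 1 \<and> B' * A = 1" for B'
    using assms that by (metis mult.assoc mult_1_left mult_1_right)
qed (simp add: assms)

theorem theorem4p6:
  fixes m :: nat
    and S :: "'h :: complex_hilbert ell2 bop"
    and W :: "int \<Rightarrow> 'h bop"
  assumes m: "m \<ge> 1"
    and shift: "bilateral_weighted_shift W S"
    and isom: "m_isometric m S"
    and pos: "\<And>j. op_pos (W j)"
    and inv: "\<And>j. op_invertible (W j)"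
  shows
    "((\<forall>i j. W i * W j = W j * W i) \<longleftrightarrow>
       (\<forall>i\<in>{1..int m - 1}. \<forall>j\<in>{1..int m - 1}. W i * W j = W j * W i)) \<and>
     ((\<forall>i\<in>{1..int m - 1}. \<forall>j\<in>{1..int m - 1}. W i * W j = W j * W i) \<longleftrightarrow>
       (\<forall>p :: 'h bop poly.
          degree p \<le> m - 1 \<and> coeff p 0 = 1 \<and>
          (\<forall>n::nat. n \<ge> 1 \<longrightarrow>
             op_poly p (of_nat n) = op_abs (prod_list (map W (rev [1..int n]))) ^ 2 \<and>
             op_poly p (- of_nat n) =
               op_inv (op_abs (prod_list (map (\<lambda>i. adj (W i)) [- int n + 1..0])) ^ 2)) \<longrightarrow>
          (\<forall>i\<in>{1..m - 1}. \<forall>j\<in>{1..m - 1}. coeff p i * coeff p j = coeff p j * coeff p i)))"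
proof -
  obtain V where "\<And>j. W j * V j = 1 \<and> V j * W j = 1"
    using inv unfolding op_invertible_def by metis
  then interpret invertible_weights W V
    by unfold_locales auto
  have sa: "adjoints (W j) (W j)" for j
    by (rule op_pos_imp_self_adjoint[OF pos])
  \<comment> \<open>After the outer factors are pulled out, the remaining sum is the m-isometry
    identity at coordinate \<open>n\<close>.\<close>
  have fdiff_moment: "(fdiff ^^ m) moment n = 0" for n
  proof -
    let ?Q = "\<lambda>k. rprod (\<lambda>j. W (n + 1 + int j)) k * lprod (\<lambda>j. W (n + 1 + int j)) k"
    have "(fdiff ^^ m) moment n
        = right n * (\<Sum>k\<le>m. (of_nat (m choose k) * (- 1) ^ (m - k)) *\<^sub>R ?Q k) * left n"
      unfolding funpow_fdiff_eq_sum moment_add by (simp add: sum_distrib_left sum_distrib_right)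
    then show ?thesis
      unfolding m_isometric_weighted_shift[OF shift isom sa] by simp
  qed
  have abs_up: "op_abs (prod_list (map W (rev [1..int n]))) ^ 2 = moment (int n)" for n
  proof -
    have "moment (int n) = rprod (\<lambda>k. W (1 + int k)) n * lprod (\<lambda>k. W (1 + int k)) n"
      by (simp add: moment_def left_def right_def)
    then show ?thesis
      unfolding prod_list_rev_upto
      using op_abs_power2[OF adjoints_lprod[OF sa] rprod_lprod_inverse[OF V_W]] by metis
  qed
  have abs_down: "op_inv (op_abs (prod_list (map (\<lambda>i. adj (W i)) [- int n + 1..0])) ^ 2)
      = moment (- int n)" for n
  proof -
    let ?W = "\<lambda>k. W (- int k)" and ?V = "\<lambda>k. V (- int k)"
    have "op_abs (lprod ?W n) ^ 2 = rprod ?W n * lprod ?W n"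
      using op_abs_power2[OF adjoints_lprod[OF sa] rprod_lprod_inverse[OF V_W]] by metis
    moreover have "moment (- int n) = rprod ?V n * lprod ?V n"
      by (cases n; simp add: moment_def left_def right_def del: of_nat_Suc)
    \<comment> \<open>Inversion reverses both halves of the product, which leaves the pattern
      \<open>rprod\<close>, \<open>lprod\<close> intact with \<open>V\<close> in place of
      \<open>W\<close>.\<close>
    moreover have "op_inv (rprod ?W n * lprod ?W n) = rprod ?V n * lprod ?V n"
    proof (rule op_inv_eqI)
      have "(rprod ?W n * lprod ?W n) * (rprod ?V n * lprod ?V n)
          = rprod ?W n * (lprod ?W n * rprod ?V n) * lprod ?V n"
        by (simp only: mult.assoc)
      then show "(rprod ?W n * lprod ?W n) * (rprod ?V n * lprod ?V n) = 1"
        by (simp add: lprod_rprod_inverse rprod_lprod_inverse W_V)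
      have "(rprod ?V n * lprod ?V n) * (rprod ?W n * lprod ?W n)
          = rprod ?V n * (lprod ?V n * rprod ?W n) * lprod ?W n"
        by (simp only: mult.assoc)
      then show "(rprod ?V n * lprod ?V n) * (rprod ?W n * lprod ?W n) = 1"
        by (simp add: lprod_rprod_inverse rprod_lprod_inverse V_W)
    qed
    ultimately show ?thesis
      unfolding adj_eqI[OF sa] prod_list_upto_0 by simp
  qed
  let ?i = "\<forall>i j. W i * W j = W j * W i"
  let ?ii = "\<forall>i\<in>{1..int m - 1}. \<forall>j\<in>{1..int m - 1}. W i * W j = W j * W i"
  let ?interp = "\<lambda>p. degree p \<le> m - 1 \<and> coeff p 0 = 1 \<and> (\<forall>n::nat. n \<ge> 1 \<longrightarrow>
    op_poly p (of_nat n) = moment (int n) \<and> op_poly p (- of_nat n) = moment (- int n))"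
  let ?iii = "\<forall>p. ?interp p \<longrightarrow>
    (\<forall>i\<in>{1..m - 1}. \<forall>j\<in>{1..m - 1}. coeff p i * coeff p j = coeff p j * coeff p i)"
  have "?iii" if ii: "?ii"
  proof (intro allI impI ballI)
    fix p i j assume p: "?interp p"
    have "W i * moment (int k) = moment (int k) * W i" if "i \<in> {1..int m - 1}" "k < m" for i k
      using ii that by (intro commute_moment) auto
    then have small: "moment (int l) * moment (int k) = moment (int k) * moment (int l)"
      if "l < m" "k < m" for l k
      using that by (intro commute_moment) auto
    \<comment> \<open>The window 0, ..., \<open>m - 1\<close> is extended to all integers in one
      index at a time.\<close>
    have "moment (int k) * moment l = moment l * moment (int k)" if "k < m" for l k
      by (rule commute_of_fdiff_eq_0[OF fdiff_moment]) (rule small[OF that])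
    then have "moment l * moment (int k) = moment (int k) * moment l" if "k < m" for l k
      using that by simp
    then have "moment l * moment k = moment k * moment l" for l k
      by (rule commute_of_fdiff_eq_0[OF fdiff_moment])
    then have "moment l * coeff p j = coeff p j * moment l" for l j
      using p by (intro commute_coeff_of_op_poly) auto
    then show "coeff p i * coeff p j = coeff p j * coeff p i"
      using p by (intro commute_coeff_of_op_poly) auto
  qed
  moreover have "?i" if iii: "?iii"
  proof -
    \<comment> \<open>Condition (iii) speaks about interpolating polynomials, so one has to be
      produced; vanishing \<open>m\<close>-th differences supply its coefficients.\<close>
    obtain a where a: "\<And>n. moment n = (\<Sum>i<m. (of_int n :: real) ^ i *\<^sub>R a i)"
      using polynomial_of_fdiff_eq_0[OF fdiff_moment] by blast
    define p where "p = Poly (map a [0..<m])"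
    have coeff: "coeff p j = (if j < m then a j else 0)" for j
      by (simp add: p_def nth_default_def)
    have deg: "degree p \<le> m - 1"
      by (rule degree_le) (auto simp: coeff)
    have "{..m - 1} = {..<m}"
      using m by auto
    then have p: "op_poly p (of_int n) = moment n" for n
      by (simp add: op_poly_of_int[OF deg] a coeff)
    \<comment> \<open>Since \<open>0 ^ 0 = 1\<close>, only the constant term survives at 0, which
      normalises \<open>p\<close>.\<close>
    have "moment 0 = (\<Sum>i<m. if i = 0 then a i else 0)"
      unfolding a by (intro sum.cong) auto
    then have "moment 0 = a 0"
      using m by simp
    then have "coeff p 0 = 1"
      using m by (simp add: coeff moment_0)
    moreover have "op_poly p (of_nat n) = moment (int n) \<and> op_poly p (- of_nat n) = moment (- int n)" for n
      using p[of "int n"] p[of "- int n"] by simp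
    ultimately have comm: "coeff p i * coeff p j = coeff p j * coeff p i"
      if "i \<in> {1..m - 1}" "j \<in> {1..m - 1}" for i j
      using iii deg that by blast
    \<comment> \<open>The indices outside (iii) carry the coefficient 1 at 0 and 0 from
      \<open>m\<close> on.\<close>
    have coeffs: "coeff p i * coeff p j = coeff p j * coeff p i" for i j
    proof (cases "i \<in> {1..m - 1} \<and> j \<in> {1..m - 1}")
      case False
      then have "i = 0 \<or> j = 0 \<or> coeff p i = 0 \<or> coeff p j = 0"
        by (auto simp: coeff)
      then show ?thesis
        using \<open>coeff p 0 = 1\<close> by auto
    qed (use comm in blast)
    have "x * moment n = moment n * x" if "\<And>j. x * coeff p j = coeff p j * x" for x n
      unfolding p[symmetric] op_poly_of_int[OF deg] using that by (intro commute_sum_scaleR)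
    then have moments: "moment k * moment l = moment l * moment k" for k l
      using coeffs by metis
    have root: "x * W j = W j * x" if "x * (W j * W j) = (W j * W j) * x" for x j
      by (rule op_pos_commute_of_square[OF pos inv that])
    \<comment> \<open>First pass: the fixed element is a moment.\<close>
    have "moment k * W j = W j * moment k" for k j
      by (rule commute_weights_of_moments) (rule root, assumption, rule moments)
    then have "W i * moment k = moment k * W i" for k i
      by (rule sym)
    \<comment> \<open>Second pass: the fixed element is a weight, which now commutes with all
      moments.\<close>
    then show ?thesis
      by (intro allI) (rule commute_weights_of_moments, rule root, assumption)
  qed
  \<comment> \<open>The cycle closes since (i) trivially implies (ii).\<close>
  ultimately have "(?i \<longleftrightarrow> ?ii) \<and> (?ii \<longleftrightarrow> ?iii)"
    by blast
  then show ?thesis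
    unfolding abs_up abs_down .
qed

end
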